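(* Assume the pressure satisfies (P1)–(P3) of the context. Then for $\rho\ge1$ the entropy kernel and entropy flux kernel may be written as $$\chi(\rho,u-s)=\chi_\rho(1,u-s)*\chi^\sharp(\rho,u-s)+\chi(1,u-s)*\chi^\flat(\rho,u-s),$$ $$(\sigma-u\chi)(\rho,u-s)=(\sigma-u\chi)_\rho(1,u-s)*\chi^\sharp(\rho,u-s)+(\sigma-u\chi)(1,u-s)*\chi^\flat(\rho,u-s),$$ where convolution is in the second variable and $$\chi^\sharp(\rho,u-s)=\tfrac12\sqrt\rho\,I_0\Big(\tfrac{\sqrt{(\log\rho)^2-|u-s|^2}}{2}\Big)\mathbf{1}_{|u-s|<\log\rho},$$ $$\chi^\flat(\rho,u-s)=\tfrac12\sqrt\rho(\delta_{u-s=\log\rho}+\delta_{u-s=-\log\rho})-\tfrac14\sqrt\rho\,I_0\Big(\tfrac{\sqrt{(\log\rho)^2-|u-s|^2}}{2}\Big)\mathbf{1}_{|u-s|<\log\rho}+\tfrac14\sqrt\rho\frac{\log\rho}{\sqrt{(\log\rho)^2-|u-s|^2}}I_1\Big(\tfrac{\sqrt{(\log\rho)^2-|u-s|^2}}{2}\Big)\mathbf{1}_{|u-s|<\log\rho}.$$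
   Context: Pressure assumptions (normalised): (P1) for $0\le\rho\le1$, $p(\rho)=\kappa\rho^\gamma(1+P(\rho))$ with $\gamma\in(1,3)$, $\kappa>0$, $|P^{(n)}(\rho)|\le M\rho^{2\theta-n}$, $n=0,\dots,3$, $\theta=\frac{\gamma-1}2$; (P2) $p(\rho)=\rho$ for $\rho\ge1$; (P3) $p'(\rho)>0$ and $\rho p''(\rho)+2p'(\rho)>0$ for $\rho>0$. With $k(\rho)=\int_0^\rho\frac{\sqrt{p'(s)}}{s}ds$, the entropy kernel $\chi(\rho,u-s)$ solves $\chi_{\rho\rho}-k'(\rho)^2\chi_{uu}=0$, $\chi|_{\rho=0}=0$, $\chi_\rho|_{\rho=0}=\delta_{u=s}$, and the entropy flux kernel $\sigma(\rho,u,s)$ is defined by $(\sigma-u\chi)_{\rho\rho}-k'(\rho)^2(\sigma-u\chi)_{uu}=\frac{p''(\rho)}{\rho}\chi_u$ with $(\sigma-u\chi)|_{\rho=0}=(\sigma-u\chi)_\rho|_{\rho=0}=0$; $\sigma-u\chi$ depends only on $(\rho,u-s)$. $I_0,I_1$ are modified Bessel functions of the first kind. *)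

theory Defs
  imports "HOL-Analysis.Analysis"
begin

definition besselI :: "nat \<Rightarrow> real \<Rightarrow> real" where
  "besselI n x = (\<Sum>m. (x / 2) ^ (2 * m + n) / (fact m * fact (m + n)))"

definition P1 :: "(real \<Rightarrow> real) \<Rightarrow> bool" where
  "P1 p \<longleftrightarrow> (\<exists>\<kappa> \<gamma> P M. 1 < \<gamma> \<and> \<gamma> < 3 \<and> \<kappa> > 0 \<and>
     (\<forall>\<rho>\<in>{0..1}. p \<rho> = \<kappa> * \<rho> powr \<gamma> * (1 + P \<rho>)) \<and>
     (\<forall>n<3. \<forall>\<rho>\<in>{0<..<1}. (deriv ^^ n) P differentiable (at \<rho>)) \<and>
     (\<forall>\<rho>\<in>{0..1}. \<bar>P \<rho>\<bar> \<le> M * \<rho> powr (\<gamma> - 1)) \<and>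
     (\<forall>n\<in>{1..3}. \<forall>\<rho>\<in>{0<..<1}.
        \<bar>(deriv ^^ n) P \<rho>\<bar> \<le> M * \<rho> powr (\<gamma> - 1 - real n)))"

definition P2 :: "(real \<Rightarrow> real) \<Rightarrow> bool" where
  "P2 p \<longleftrightarrow> (\<forall>\<rho>\<ge>1. p \<rho> = \<rho>)"

definition P3 :: "(real \<Rightarrow> real) \<Rightarrow> bool" where
  "P3 p \<longleftrightarrow> (\<forall>\<rho>>0. p differentiable (at \<rho>) \<and> deriv p differentiable (at \<rho>) \<and>
     deriv p \<rho> > 0 \<and> \<rho> * deriv (deriv p) \<rho> + 2 * deriv p \<rho> > 0)"

text \<open>k'(rho) = sqrt(p'(rho))/rho, the derivative of k(rho) = int_0^rho sqrt(p'(s))/s ds.\<close>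
definition kprime :: "(real \<Rightarrow> real) \<Rightarrow> real \<Rightarrow> real" where
  "kprime p \<rho> = sqrt (deriv p \<rho>) / \<rho>"

definition test1 :: "(real \<Rightarrow> real) \<Rightarrow> bool" where
  "test1 \<psi> \<longleftrightarrow> (\<forall>n x. ((deriv ^^ n) \<psi> has_real_derivative (deriv ^^ Suc n) \<psi> x) (at x))
      \<and> (\<exists>R. \<forall>x. \<bar>x\<bar> > R \<longrightarrow> \<psi> x = 0)"

definition pd_r :: "(real \<Rightarrow> real \<Rightarrow> real) \<Rightarrow> real \<Rightarrow> real \<Rightarrow> real" where
  "pd_r f r v = deriv (\<lambda>t. f t v) r"

definition pd_v :: "(real \<Rightarrow> real \<Rightarrow> real) \<Rightarrow> real \<Rightarrow> real \<Rightarrow> real" where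
  "pd_v f r v = deriv (\<lambda>t. f r t) v"

fun pd_word :: "bool list \<Rightarrow> (real \<Rightarrow> real \<Rightarrow> real) \<Rightarrow> real \<Rightarrow> real \<Rightarrow> real" where
  "pd_word [] f = f"
| "pd_word (b # bs) f = (if b then pd_r else pd_v) (pd_word bs f)"

definition test2 :: "(real \<Rightarrow> real \<Rightarrow> real) \<Rightarrow> bool" where
  "test2 \<phi> \<longleftrightarrow>
     (\<forall>w. continuous_on UNIV (\<lambda>(r, v). pd_word w \<phi> r v) \<and>
          (\<forall>r v. (\<lambda>t. pd_word w \<phi> t v) differentiable (at r) \<and>
                 (\<lambda>t. pd_word w \<phi> r t) differentiable (at v))) \<and>
     (\<exists>a b R. 0 < a \<and> a < b \<and> (\<forall>r v. \<phi> r v \<noteq> 0 \<longrightarrow> a \<le> r \<and> r \<le> b \<and> \<bar>v\<bar> \<le> R))"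

definition pair :: "(real \<Rightarrow> real \<Rightarrow> real) \<Rightarrow> real \<Rightarrow> (real \<Rightarrow> real) \<Rightarrow> real" where
  "pair f r \<psi> = (LBINT v. f r v * \<psi> v)"

definition pair_r :: "(real \<Rightarrow> real \<Rightarrow> real) \<Rightarrow> real \<Rightarrow> (real \<Rightarrow> real) \<Rightarrow> real" where
  "pair_r f r \<psi> = deriv (\<lambda>t. pair f t \<psi>) r"

text \<open>chi(rho,v), v = u - s, solves chi_rr - k'^2 chi_vv = 0 in D'((0,oo) x R),
  chi(0,.) = 0, chi_rho(0,.) = delta_0.\<close>
definition entropy_kernel :: "(real \<Rightarrow> real) \<Rightarrow> (real \<Rightarrow> real \<Rightarrow> real) \<Rightarrow> bool" where
  "entropy_kernel p chi \<longleftrightarrow>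
     continuous_on ({0<..} \<times> UNIV) (\<lambda>(r, v). chi r v) \<and>
     (\<forall>\<phi>. test2 \<phi> \<longrightarrow>
        (LBINT r. LBINT v. chi r v *
           (pd_r (pd_r \<phi>) r v - (kprime p r)\<^sup>2 * pd_v (pd_v \<phi>) r v)) = 0) \<and>
     (\<forall>\<psi>. test1 \<psi> \<longrightarrow>
        (\<forall>r>0. (\<lambda>t. pair chi t \<psi>) differentiable (at r)) \<and>
        ((\<lambda>r. pair chi r \<psi>) \<longlongrightarrow> 0) (at_right 0) \<and>
        ((\<lambda>r. pair_r chi r \<psi>) \<longlongrightarrow> \<psi> 0) (at_right 0))"

text \<open>h = sigma - u chi, as a function of (rho, v), v = u - s, solves
  h_rr - k'^2 h_vv = (p''(rho)/rho) chi_v in D'((0,oo) x R), h(0,.) = h_rho(0,.) = 0.\<close>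
definition entropy_flux_kernel ::
  "(real \<Rightarrow> real) \<Rightarrow> (real \<Rightarrow> real \<Rightarrow> real) \<Rightarrow> (real \<Rightarrow> real \<Rightarrow> real \<Rightarrow> real) \<Rightarrow> (real \<Rightarrow> real \<Rightarrow> real) \<Rightarrow> bool" where
  "entropy_flux_kernel p chi \<sigma> h \<longleftrightarrow>
     (\<forall>r u s. \<sigma> r u s - u * chi r (u - s) = h r (u - s)) \<and>
     continuous_on ({0<..} \<times> UNIV) (\<lambda>(r, v). h r v) \<and>
     (\<forall>\<phi>. test2 \<phi> \<longrightarrow>
        (LBINT r. LBINT v. h r v *
           (pd_r (pd_r \<phi>) r v - (kprime p r)\<^sup>2 * pd_v (pd_v \<phi>) r v)) =
        - (LBINT r. LBINT v. deriv (deriv p) r / r * chi r v * pd_v \<phi> r v)) \<and>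
     (\<forall>\<psi>. test1 \<psi> \<longrightarrow>
        (\<forall>r>0. (\<lambda>t. pair h t \<psi>) differentiable (at r)) \<and>
        ((\<lambda>r. pair h r \<psi>) \<longlongrightarrow> 0) (at_right 0) \<and>
        ((\<lambda>r. pair_r h r \<psi>) \<longlongrightarrow> 0) (at_right 0))"

definition chi_sharp :: "real \<Rightarrow> real \<Rightarrow> real" where
  "chi_sharp \<rho> v = (if \<bar>v\<bar> < ln \<rho> then
      1/2 * sqrt \<rho> * besselI 0 (sqrt ((ln \<rho>)\<^sup>2 - v\<^sup>2) / 2) else 0)"

text \<open>Absolutely continuous part of chi-flat (the Dirac part is treated separately).\<close>
definition chi_flat_ac :: "real \<Rightarrow> real \<Rightarrow> real" where
  "chi_flat_ac \<rho> v = (if \<bar>v\<bar> < ln \<rho> then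
      - 1/4 * sqrt \<rho> * besselI 0 (sqrt ((ln \<rho>)\<^sup>2 - v\<^sup>2) / 2)
      + 1/4 * sqrt \<rho> * ln \<rho> / sqrt ((ln \<rho>)\<^sup>2 - v\<^sup>2)
          * besselI 1 (sqrt ((ln \<rho>)\<^sup>2 - v\<^sup>2) / 2) else 0)"

text \<open>For a kernel g (even in v), pairing (T * g) with psi equals pairing T with
  w \<mapsto> int g(v - w) psi(v) dv.\<close>
definition conv_sharp :: "real \<Rightarrow> (real \<Rightarrow> real) \<Rightarrow> real \<Rightarrow> real" where
  "conv_sharp \<rho> \<psi> w = (LBINT v. chi_sharp \<rho> (v - w) * \<psi> v)"

definition conv_flat :: "real \<Rightarrow> (real \<Rightarrow> real) \<Rightarrow> real \<Rightarrow> real" where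
  "conv_flat \<rho> \<psi> w = 1/2 * sqrt \<rho> * (\<psi> (w + ln \<rho>) + \<psi> (w - ln \<rho>))
      + (LBINT v. chi_flat_ac \<rho> (v - w) * \<psi> v)"

end

theory Submission
  imports Defs "HOL-Real_Asymp.Real_Asymp"
begin

text \<open>For \<open>r > 1\<close> both kernels solve \<open>f_rr = f_vv / r\<^sup>2\<close> weakly, because there \<open>p' = 1\<close> and \<open>p'' = 0\<close>. Given a test
  function \<open>\<psi>\<close> and a time \<open>\<rho>\<close>, let \<open>w\<close> be the smooth solution of the same equation with \<open>w = 0\<close>,
  \<open>w_r = - \<psi> / sqrt \<rho>\<close> at \<open>r = \<rho>\<close>; it is explicit in terms of Bessel functions. Testing with \<open>a(r) w(r, v)\<close> for a bump
  \<open>a\<close> gives \<open>\<integral> (a'' A + 2 a' B) dr = 0\<close>, where \<open>A\<close> and \<open>B\<close> are the pairings of \<open>f\<close> with \<open>w\<close> and \<open>w_r\<close>. By the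
  du Bois-Reymond lemma \<open>A' - 2 B\<close> is constant on \<open>r \<ge> 1\<close>, that is, the Wronskian \<open>\<langle>f_r, w\<rangle> - \<langle>f, w_r\<rangle>\<close> is conserved.
  Its value at \<open>r = \<rho>\<close> is \<open>\<langle>f, \<psi>\<rangle> / sqrt \<rho>\<close>, and its value at \<open>r = 1\<close> is the right-hand side divided by \<open>sqrt \<rho>\<close>.\<close>

section \<open>Bessel series\<close>

text \<open>The obstacle is low regularity: \<open>f\<close> is merely continuous, and its pairing
  with a fixed test function is differentiable in \<open>r\<close> without any control of that
  derivative. All derivatives are therefore moved onto \<open>w\<close>, and conservation is
  obtained first in integrated form, as an affine law with slope \<open>m\<close>. The equation is
  exploited only through test functions supported in r > 1, whereas the data sit at r = 1.
  Continuity carries the affine law to r = 1, and differentiability of the pairing there identifies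
  its one-sided slope with \<open>pair_r f 1\<close>. The kernels are read off at r = 1: up to the
  factor \<open>sqrt \<rho>\<close>, \<open>chi_sharp\<close> is the kernel of \<open>w\<close> and
  \<open>chi_flat\<close> that of \<open>- w_r\<close>. In the latter the term with -1/4 is the
  derivative of a factor \<open>sqrt r\<close> in \<open>w\<close>, the Dirac masses come from the
  moving edges of the light cone, and the term with \<open>besselI 1\<close> from differentiating
  \<open>besselI 0\<close>.\<close>

definition besselC :: "nat \<Rightarrow> real \<Rightarrow> real" where
  "besselC n z = (\<Sum>m. z ^ m / (fact m * fact (m + n)))"

lemma summable_besselC: "summable (\<lambda>m. z ^ m / (fact m * fact (m + n)) :: real)"
proof (rule summable_comparison_test')
  show "summable (\<lambda>m. norm (z ^ m /\<^sub>R fact m))"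
    by (rule summable_norm_exp)
  show "norm (z ^ m / (fact m * fact (m + n))) \<le> norm (z ^ m /\<^sub>R fact m)" if "0 \<le> m" for m
  proof -
    have "(1::real) \<le> fact (m + n)" by simp
    then have "norm (z ^ m) / (fact m * fact (m + n)) \<le> norm (z ^ m) / (fact m * 1)"
      by (intro divide_left_mono mult_left_mono) auto
    then show ?thesis by (simp add: norm_divide divide_inverse abs_mult mult.commute)
  qed
qed

text \<open>Termwise differentiation cancels \<open>m\<close> against \<open>fact m\<close> only and
  leaves the other factorial alone, which raises the index by one.\<close>

lemma DERIV_besselC: "(besselC n has_real_derivative besselC (Suc n) z) (at z)"
proof -
  define c where "c = (\<lambda>m. 1 / (fact m * fact (m + n)) :: real)"
  have "((\<lambda>x. \<Sum>m. c m * x ^ m) has_real_derivative (\<Sum>m. diffs c m * z ^ m)) (at z)"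
    by (rule termdiffs_strong_converges_everywhere)
      (use summable_besselC[of _ n] in \<open>simp add: c_def\<close>)
  moreover have "(\<lambda>x. \<Sum>m. c m * x ^ m) = besselC n"
    by (simp add: c_def besselC_def fun_eq_iff)
  moreover have "diffs c m * z ^ m = z ^ m / (fact m * fact (m + Suc n))" for m
    by (simp add: diffs_def c_def divide_simps)
  ultimately show ?thesis by (simp add: besselC_def)
qed

text \<open>Bessel's equation C' + z C'' = C for C = \<open>besselC 0\<close>, since differentiation
  shifts the index. It produces the zeroth-order term of the Klein-Gordon equation. On coefficients,
  (1 + m) / (m! (m + 1)!) = 1 / (m!)^2.\<close>

lemma besselC_recurrence: "besselC 1 z + z * besselC 2 z = besselC 0 z"
proof -
  \<comment> \<open>The series of \<open>z * besselC 2 z\<close> shifted by one index, so that it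
    runs over the same powers as \<open>besselC 1 z\<close>; the factor \<open>m\<close> makes the
    new zeroth term vanish.\<close>
  define t :: "nat \<Rightarrow> real" where "t m = real m * z ^ m / (fact m * fact (m + 1))" for m
  have t_Suc: "t (Suc m) = z * (z ^ m / (fact m * fact (m + 2)))" for m
  proof -
    have "t (Suc m) = (1 + real m) * z ^ Suc m / ((1 + real m) * (fact m * fact (m + 2)))"
      by (simp add: t_def algebra_simps)
    then show ?thesis by (simp add: divide_simps)
  qed
  have "(\<lambda>m. t (Suc m)) sums (z * besselC 2 z)"
    unfolding t_Suc besselC_def by (intro sums_mult summable_sums summable_besselC)
  moreover have "t 0 = 0" by (simp add: t_def)
  ultimately have "t sums (z * besselC 2 z)"
    by (simp add: sums_Suc_iff)
  moreover have "(\<lambda>m. z ^ m / (fact m * fact (m + 1))) sums besselC 1 z"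
    unfolding besselC_def by (intro summable_sums summable_besselC)
  ultimately have "(\<lambda>m. z ^ m / (fact m * fact (m + 1)) + t m) sums (besselC 1 z + z * besselC 2 z)"
    by (intro sums_add)
  moreover have "z ^ m / (fact m * fact (m + 1)) + t m = z ^ m / (fact m * fact (m + 0))" for m
  proof -
    have "z ^ m / (fact m * fact (m + 1)) + t m = (1 + real m) * z ^ m / ((1 + real m) * (fact m * fact m))"
      by (simp add: t_def add_divide_distrib algebra_simps)
    then show ?thesis by (simp add: divide_simps)
  qed
  ultimately show ?thesis
    unfolding besselC_def[of 0] by (simp add: sums_iff)
qed

text \<open>The reason for \<open>besselC\<close> (the Bessel-Clifford function): as an entire
  function of the squared argument it removes the square roots, so that the kernels extend smoothly
  over the edge of the light cone and to either sign of time.\<close>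

lemma besselI_besselC: "besselI n x = (x / 2) ^ n * besselC n (x\<^sup>2 / 4)"
proof -
  have "x\<^sup>2 / 4 = (x / 2)\<^sup>2" by (simp add: power2_eq_square)
  have "(x / 2) ^ n * besselC n (x\<^sup>2 / 4)
      = (\<Sum>m. (x / 2) ^ n * ((x\<^sup>2 / 4) ^ m / (fact m * fact (m + n))))"
    unfolding besselC_def by (intro suminf_mult[symmetric] summable_besselC)
  also have "\<dots> = besselI n x"
    unfolding besselI_def
    by (rule suminf_cong) (simp only: \<open>x\<^sup>2 / 4 = _\<close> power_add power_mult, simp add: mult.commute)
  finally show ?thesis by simp
qed

section \<open>Smooth functions and bumps\<close>

text \<open>The derivative is quantified existentially instead of being
  \<open>(deriv ^^ n) f\<close>, so that each closure rule is an induction that just supplies a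
  derivative. Continuity of the last derivative is not asked for; it is automatic once all orders
  exist.\<close>

fun Ck :: "nat \<Rightarrow> (real \<Rightarrow> real) \<Rightarrow> bool" where
  "Ck 0 f = True"
| "Ck (Suc n) f = (\<exists>f'. (\<forall>x. (f has_real_derivative f' x) (at x)) \<and> Ck n f')"

definition smooth :: "(real \<Rightarrow> real) \<Rightarrow> bool" where
  "smooth f \<longleftrightarrow> (\<forall>n. Ck n f)"

lemma Ck_SucI:
  assumes "\<And>x. (f has_real_derivative f' x) (at x)" "Ck n f'"
  shows "Ck (Suc n) f"
  unfolding Ck.simps(2) using assms by (intro exI[of _ f'] conjI allI)

lemma Ck_SucE:
  assumes "Ck (Suc n) f"
  obtains f' where "\<And>x. (f has_real_derivative f' x) (at x)" "Ck n f'"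
  using assms unfolding Ck.simps(2) by blast

lemma Ck_Suc: "Ck (Suc n) f \<Longrightarrow> Ck n f"
proof (induction n arbitrary: f)
  case (Suc n)
  from Suc.prems obtain f' where
    f': "\<And>x. (f has_real_derivative f' x) (at x)" "Ck (Suc n) f'" by (rule Ck_SucE) (rule that)
  show ?case by (rule Ck_SucI[OF f'(1) Suc.IH[OF f'(2)]])
qed simp

lemma Ck_const: "Ck n (\<lambda>x. c)"
proof (induction n arbitrary: c)
  case (Suc n)
  show ?case by (rule Ck_SucI[OF DERIV_const Suc])
qed simp

lemma Ck_add: "Ck n f \<Longrightarrow> Ck n g \<Longrightarrow> Ck n (\<lambda>x. f x + g x)"
proof (induction n arbitrary: f g)
  case (Suc n)
  from Suc.prems(1) obtain f' where
    f': "\<And>x. (f has_real_derivative f' x) (at x)" "Ck n f'" by (rule Ck_SucE) (rule that)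
  from Suc.prems(2) obtain g' where
    g': "\<And>x. (g has_real_derivative g' x) (at x)" "Ck n g'" by (rule Ck_SucE) (rule that)
  show ?case by (rule Ck_SucI[OF DERIV_add[OF f'(1) g'(1)] Suc.IH[OF f'(2) g'(2)]])
qed simp

lemma Ck_mult: "Ck n f \<Longrightarrow> Ck n g \<Longrightarrow> Ck n (\<lambda>x. f x * g x)"
proof (induction n arbitrary: f g)
  case (Suc n)
  from Suc.prems(1) obtain f' where
    f': "\<And>x. (f has_real_derivative f' x) (at x)" "Ck n f'" by (rule Ck_SucE) (rule that)
  from Suc.prems(2) obtain g' where
    g': "\<And>x. (g has_real_derivative g' x) (at x)" "Ck n g'" by (rule Ck_SucE) (rule that)
  show ?case
    by (rule Ck_SucI[OF DERIV_mult[OF f'(1) g'(1)]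
        Ck_add[OF Suc.IH[OF f'(2) Ck_Suc[OF Suc.prems(2)]] Suc.IH[OF g'(2) Ck_Suc[OF Suc.prems(1)]]]])
qed simp

lemma Ck_affine: "Ck n f \<Longrightarrow> Ck n (\<lambda>x. f (c * x + d))"
proof (induction n arbitrary: f)
  case (Suc n)
  from Suc.prems obtain f' where
    f': "\<And>x. (f has_real_derivative f' x) (at x)" "Ck n f'" by (rule Ck_SucE) (rule that)
  have "((\<lambda>x. f (c * x + d)) has_real_derivative f' (c * x + d) * c) (at x)" for x
  proof -
    have "((\<lambda>x. c * x + d) has_real_derivative c) (at x)"
      by (auto intro!: derivative_eq_intros)
    from DERIV_chain2[OF f'(1) this] show ?thesis .
  qed
  moreover have "Ck n (\<lambda>x. f' (c * x + d) * c)"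
    by (intro Ck_mult[of n "\<lambda>x. f' (c * x + d)"] Ck_const Suc.IH[OF f'(2)])
  ultimately show ?case by (rule Ck_SucI)
qed simp

lemma smooth_const: "smooth (\<lambda>x. c)"
  by (simp add: smooth_def Ck_const)

lemma smooth_add: "smooth f \<Longrightarrow> smooth g \<Longrightarrow> smooth (\<lambda>x. f x + g x)"
  and smooth_mult: "smooth f \<Longrightarrow> smooth g \<Longrightarrow> smooth (\<lambda>x. f x * g x)"
  and smooth_affine: "smooth f \<Longrightarrow> smooth (\<lambda>x. f (c * x + d))"
  by (simp_all add: smooth_def Ck_add Ck_mult Ck_affine)

lemma smoothI:
  assumes "\<And>x. (f has_real_derivative f' x) (at x)" "smooth f'"
  shows "smooth f"
  unfolding smooth_def
proof
  fix n
  from assms(2) have "Ck n f'" by (simp add: smooth_def)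
  with assms(1) show "Ck n f" by (rule Ck_Suc[OF Ck_SucI])
qed

lemma smooth_DERIV:
  assumes "smooth f"
  shows "(f has_real_derivative deriv f x) (at x)"
proof -
  from assms have "Ck (Suc 0) f" by (simp only: smooth_def)
  then obtain f' where f': "\<And>x. (f has_real_derivative f' x) (at x)" by (rule Ck_SucE) (rule that)
  from f'[of x] DERIV_imp_deriv[OF f'[of x]] show ?thesis by simp
qed

lemma smooth_deriv: 
  assumes "smooth f"
  shows "smooth (deriv f)"
  unfolding smooth_def
proof
  fix n
  from assms have "Ck (Suc n) f" by (simp only: smooth_def)
  then obtain f' where f': "\<And>x. (f has_real_derivative f' x) (at x)" "Ck n f'" by (rule Ck_SucE) (rule that)
  from f'(1) have "deriv f = f'" by (intro ext DERIV_imp_deriv)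
  with f' show "Ck n (deriv f)" by simp
qed

lemma smooth_iff: "smooth f \<longleftrightarrow>
  (\<forall>n x. ((deriv ^^ n) f has_real_derivative (deriv ^^ Suc n) f x) (at x))"
proof
  assume f: "smooth f"
  have "smooth ((deriv ^^ n) f)" for n
    by (induction n) (simp_all add: f smooth_deriv)
  then show "\<forall>n x. ((deriv ^^ n) f has_real_derivative (deriv ^^ Suc n) f x) (at x)"
    by (simp add: smooth_DERIV)
next
  assume f: "\<forall>n x. ((deriv ^^ n) f has_real_derivative (deriv ^^ Suc n) f x) (at x)"
  have "Ck k ((deriv ^^ n) f)" for k n
  proof (induction k arbitrary: n)
    case (Suc k)
    show ?case by (rule Ck_SucI[OF f[rule_format] Suc])
  qed simp
  from this[of _ 0] have "Ck k f" for k by simp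
  then show "smooth f" by (simp add: smooth_def)
qed

lemma smooth_imp_continuous_on: "smooth f \<Longrightarrow> continuous_on S f"
  by (meson DERIV_continuous_on has_field_derivative_at_within smooth_DERIV)

lemma test1_iff: "test1 \<psi> \<longleftrightarrow> smooth \<psi> \<and> (\<exists>R. \<forall>x. \<bar>x\<bar> > R \<longrightarrow> \<psi> x = 0)"
  by (simp only: test1_def smooth_iff)

lemma deriv_eq_0_of_eventually:
  fixes f :: "real \<Rightarrow> real"
  assumes "eventually (\<lambda>y. f y = 0) (nhds x)"
  shows "deriv f x = 0"
  using deriv_cong_ev[OF assms refl] by simp

text \<open>The negative powers make the family stable, up to linear combinations, under
  differentiation; smoothness of all members then follows by one induction on the order.\<close>

definition flat_exp :: "nat \<Rightarrow> real \<Rightarrow> real" where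
  "flat_exp i x = (if x > 0 then exp (- (1 / x)) / x ^ i else 0)"

lemma DERIV_flat_exp:
  "(flat_exp i has_real_derivative flat_exp (i + 2) x - real i * flat_exp (i + 1) x) (at x)"
proof -
  consider "x < 0" | "x = 0" | "x > 0" by linarith
  then show ?thesis
  proof cases
    case 1
    then have "eventually (\<lambda>y. y < 0) (nhds x)"
      using eventually_nhds_in_open[of "{..<0}" x] by simp
    then have "eventually (\<lambda>y. flat_exp i y = 0) (nhds x)"
      by eventually_elim (simp add: flat_exp_def)
    then show ?thesis using 1 DERIV_cong_ev[of x x "flat_exp i" "\<lambda>_. 0" 0 0]
      by (auto simp: flat_exp_def)
  next
    case 2
    \<comment> \<open>At 0 the difference quotient of \<open>flat_exp i\<close> is again a member of
      the family, so a single limit suffices.\<close>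
    have "((\<lambda>h. flat_exp (Suc i) h) \<longlongrightarrow> 0) (at 0)"
    proof (rule filterlim_split_at)
      show "(flat_exp (Suc i) \<longlongrightarrow> 0) (at_left 0)"
        by (rule tendsto_eventually) (auto simp: flat_exp_def eventually_at_filter)
      have "((\<lambda>h. exp (- (1 / h)) / h ^ Suc i :: real) \<longlongrightarrow> 0) (at_right 0)"
        by real_asymp
      then show "(flat_exp (Suc i) \<longlongrightarrow> 0) (at_right 0)"
        by (rule Lim_transform_eventually) (auto simp: flat_exp_def eventually_at_filter)
    qed
    moreover have "(flat_exp i (0 + h) - flat_exp i 0) / h = flat_exp (Suc i) h" for h
      by (auto simp: flat_exp_def)
    ultimately show ?thesis using 2
      by (simp add: DERIV_def) (simp add: flat_exp_def)
  next
    case 3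
    then have "eventually (\<lambda>y. y > 0) (nhds x)"
      using eventually_nhds_in_open[of "{0<..}" x] by simp
    then have ev: "eventually (\<lambda>y. flat_exp i y = exp (- inverse y) * inverse y ^ i) (nhds x)"
      by eventually_elim (simp add: flat_exp_def field_simps)
    have 1: "(inverse has_real_derivative - (inverse x ^ 2)) (at x)"
      using 3 DERIV_inverse[of x] by (simp add: numeral_2_eq_2)
    have "((\<lambda>y. inverse y ^ i) has_real_derivative - (real i * inverse x ^ (i + 1))) (at x)"
      using DERIV_power[OF 1, of i] by (cases i) (simp_all add: power2_eq_square mult_ac)
    moreover have "((\<lambda>y. exp (- inverse y)) has_real_derivative exp (- inverse x) * inverse x ^ 2) (at x)"
      using DERIV_fun_exp[OF DERIV_minus[OF 1]] by simp
    ultimately have "((\<lambda>y. exp (- inverse y) * inverse y ^ i) has_real_derivative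
        exp (- inverse x) * inverse x ^ 2 * inverse x ^ i
        + - (real i * inverse x ^ (i + 1)) * exp (- inverse x)) (at x)"
      by (intro DERIV_mult)
    moreover have "exp (- inverse x) * inverse x ^ 2 * inverse x ^ i
        + - (real i * inverse x ^ (i + 1)) * exp (- inverse x)
        = flat_exp (i + 2) x - real i * flat_exp (i + 1) x"
      using 3 by (simp add: flat_exp_def field_simps power_add power2_eq_square)
    ultimately show ?thesis using DERIV_cong_ev[OF refl ev refl] by simp
  qed
qed

lemma smooth_flat_exp: "smooth (flat_exp i)"
proof -
  have "Ck n (flat_exp i)" for n
  proof (induction n arbitrary: i)
    case (Suc n)
    have "Ck n (\<lambda>x. flat_exp (i + 2) x + (- real i) * flat_exp (i + 1) x)"
      by (intro Ck_add Ck_mult Ck_const Suc)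
    then have "Ck n (\<lambda>x. flat_exp (i + 2) x - real i * flat_exp (i + 1) x)" by simp
    from Ck_SucI[OF DERIV_flat_exp this] show ?case .
  qed simp
  then show ?thesis by (simp add: smooth_def)
qed

section \<open>Compactly supported integrals, ramps and the du Bois-Reymond lemma\<close>

lemma lborel_integral_compact_support:
  fixes g :: "real \<Rightarrow> real"
  assumes "continuous_on {a..b} g" and "\<And>x. x \<notin> {a..b} \<Longrightarrow> g x = 0"
  shows "integrable lborel g" "(LBINT x. g x) = integral {a..b} g"
proof -
  have si: "set_integrable lborel {a..b} g"
    by (rule borel_integrable_atLeastAtMost'[OF assms(1)])
  have eq: "(\<lambda>x. indicator {a..b} x * g x) = g"
    using assms(2) by (auto simp: indicator_def fun_eq_iff)
  from si show "integrable lborel g" by (simp add: set_integrable_def eq)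
  from set_borel_integral_eq_integral(2)[OF si]
  show "(LBINT x. g x) = integral {a..b} g" by (simp add: set_lebesgue_integral_def eq)
qed

lemma smooth_antiderivative:
  assumes "smooth g"
  obtains G where "smooth G" "\<And>x. (G has_real_derivative g x) (at x)" "G 0 = 0"
proof -
  have "\<exists>F. \<forall>x :: real. (-\<infinity>) < ereal x \<longrightarrow> ereal x < \<infinity> \<longrightarrow> (F has_vector_derivative g x) (at x)"
    using smooth_imp_continuous_on[OF assms, of UNIV]
    by (intro einterval_antiderivative) (auto simp: continuous_on_eq_continuous_at)
  then obtain F where F: "\<And>x. (F has_real_derivative g x) (at x)"
    by (auto simp: has_real_derivative_iff_has_vector_derivative)
  have 1: "((\<lambda>x. F x - F 0) has_real_derivative g x) (at x)" for x
    using DERIV_diff[OF F[of x] DERIV_const[of "F 0"]] by simp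
  show ?thesis by (rule that[OF smoothI[OF 1 assms] 1]) simp
qed

lemma DERIV_eq_imp_affine:
  fixes G :: "real \<Rightarrow> real"
  assumes "convex S" and "\<And>x. x \<in> S \<Longrightarrow> (G has_real_derivative m) (at x)" and "x \<in> S" "y \<in> S"
  shows "G x = G y + m * (x - y)"
proof -
  have "\<exists>c. \<forall>x\<in>S. G x - m * x = c"
  proof (rule has_field_derivative_zero_constant[OF assms(1)])
    show "((\<lambda>x. G x - m * x) has_real_derivative 0) (at x within S)" if "x \<in> S" for x
      using DERIV_diff[OF assms(2)[OF that] DERIV_cmult_Id[of m x]]
      by (auto intro: has_field_derivative_at_within)
  qed
  then have "G x - m * x = G y - m * y" using assms(3,4) by metis
  then show ?thesis by (simp add: algebra_simps)
qed

text \<open>A double primitive of a bump. It is affine on both sides of the bump, so a combination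
  of translates that annihilates affine functions is compactly supported, hence admissible, while
  its second derivative is a combination of bumps.\<close>

lemma smooth_ramp:
  obtains \<Theta> H \<eta> :: "real \<Rightarrow> real" and c m where
    "smooth \<Theta>" "\<And>x. (\<Theta> has_real_derivative H x) (at x)"
    "\<And>x. (H has_real_derivative \<eta> x) (at x)" "smooth \<eta>"
    "\<And>x. x \<le> 0 \<Longrightarrow> \<Theta> x = 0" "\<And>x. x \<ge> 1 \<Longrightarrow> \<Theta> x = c + m * x"
    "\<And>x. x \<notin> {0..1} \<Longrightarrow> \<eta> x = 0" "integral {0..1} \<eta> > 0"
proof -
  \<comment> \<open>One factor vanishes for x \<le> 0, the other for x \<ge> 1.\<close>
  define \<eta> where "\<eta> x = flat_exp 0 x * flat_exp 0 ((-1) * x + 1)" for x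
  have \<eta>: "smooth \<eta>"
    unfolding \<eta>_def by (intro smooth_mult smooth_flat_exp smooth_affine[OF smooth_flat_exp])
  have \<eta>0: "\<eta> x = 0" if "x \<le> 0 \<or> x \<ge> 1" for x
    using that by (auto simp: \<eta>_def flat_exp_def)
  have \<eta>pos: "\<eta> x > 0" if "0 < x" "x < 1" for x
    using that by (simp add: \<eta>_def flat_exp_def)
  have \<eta>nn: "\<eta> x \<ge> 0" for x
    by (simp add: \<eta>_def flat_exp_def)
  obtain H where H: "smooth H" "\<And>x. (H has_real_derivative \<eta> x) (at x)" "H 0 = 0"
    by (rule smooth_antiderivative[OF \<eta>]) (rule that)
  obtain \<Theta> where \<Theta>: "smooth \<Theta>" "\<And>x. (\<Theta> has_real_derivative H x) (at x)" "\<Theta> 0 = 0"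
    by (rule smooth_antiderivative[OF H(1)]) (rule that)
  have H0: "H x = 0" if "x \<le> 0" for x
  proof -
    have "H x = H 0 + 0 * (x - 0)"
    proof (rule DERIV_eq_imp_affine)
      show "(H has_real_derivative 0) (at y)" if "y \<in> {..0}" for y
        using H(2)[of y] \<eta>0[of y] that by simp
    qed (use that in auto)
    then show ?thesis using H(3) by simp
  qed
  have H1: "H x = H 1" if "x \<ge> 1" for x
  proof -
    have "H x = H 1 + 0 * (x - 1)"
    proof (rule DERIV_eq_imp_affine)
      show "(H has_real_derivative 0) (at y)" if "y \<in> {1..}" for y
        using H(2)[of y] \<eta>0[of y] that by simp
    qed (use that in auto)
    then show ?thesis by simp
  qed
  have \<Theta>0: "\<Theta> x = 0" if "x \<le> 0" for x
  proof -
    have "\<Theta> x = \<Theta> 0 + 0 * (x - 0)"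
    proof (rule DERIV_eq_imp_affine)
      show "(\<Theta> has_real_derivative 0) (at y)" if "y \<in> {..0}" for y
        using \<Theta>(2)[of y] H0[of y] that by simp
    qed (use that in auto)
    then show ?thesis using \<Theta>(3) by simp
  qed
  have \<Theta>1: "\<Theta> x = (\<Theta> 1 - H 1) + H 1 * x" if "x \<ge> 1" for x
  proof -
    have "\<Theta> x = \<Theta> 1 + H 1 * (x - 1)"
    proof (rule DERIV_eq_imp_affine)
      show "(\<Theta> has_real_derivative H 1) (at y)" if "y \<in> {1..}" for y
        using \<Theta>(2)[of y] H1[of y] that by (metis atLeast_iff)
    qed (use that in auto)
    then show ?thesis by (simp add: algebra_simps)
  qed
  have "integral {0..1} \<eta> \<noteq> 0"
  proof
    assume "integral {0..1} \<eta> = 0"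
    then have "\<eta> (1/2) = 0"
      using integral_eq_0_iff[of 0 1 \<eta>] \<eta>nn smooth_imp_continuous_on[OF \<eta>] by auto
    then show False using \<eta>pos[of "1/2"] by simp
  qed
  moreover have "integral {0..1} \<eta> \<ge> 0"
    by (intro integral_nonneg integrable_continuous_real smooth_imp_continuous_on \<eta> \<eta>nn)
  ultimately have "integral {0..1} \<eta> > 0" by linarith
  moreover have "\<eta> x = 0" if "x \<notin> {0..1}" for x
    using \<eta>0[of x] that by auto
  ultimately show ?thesis
    by (intro that[OF \<Theta>(1,2) H(2) \<eta> \<Theta>0 \<Theta>1]) simp_all
qed

lemma integral_param_continuous:
  fixes f :: "'a::topological_space \<Rightarrow> real \<Rightarrow> real"
  assumes "continuous_on (S \<times> {a..b}) (\<lambda>(x, t). f x t)"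
  shows "continuous_on S (\<lambda>x. integral {a..b} (f x))"
  using integral_continuous_on_param[of S a b f] assms by simp

text \<open>Tested against second derivatives of bumps, a continuous function satisfies every affine relation
  between its values at three points; this needs only a mollifier concentrating at each of them.\<close>

lemma weak_second_derivative_0_imp_affine:
  fixes D :: "real \<Rightarrow> real"
  assumes D: "continuous_on UNIV D"
    and weak: "\<And>a \<alpha> \<beta>. smooth a \<Longrightarrow> 1 < \<alpha> \<Longrightarrow> (\<And>x. x \<notin> {\<alpha>..\<beta>} \<Longrightarrow> a x = 0) \<Longrightarrow>
      (LBINT x. deriv (deriv a) x * D x) = 0"
  obtains c m where "\<And>r. r \<ge> 1 \<Longrightarrow> D r = c + m * r"
proof -
  obtain \<Theta> H \<eta> :: "real \<Rightarrow> real" and c m where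
    \<Theta>: "smooth \<Theta>" "\<And>x. (\<Theta> has_real_derivative H x) (at x)"
    "\<And>x. (H has_real_derivative \<eta> x) (at x)" "smooth \<eta>"
    "\<And>x. x \<le> 0 \<Longrightarrow> \<Theta> x = 0" "\<And>x. x \<ge> 1 \<Longrightarrow> \<Theta> x = c + m * x"
    "\<And>x. x \<notin> {0..1} \<Longrightarrow> \<eta> x = 0" "integral {0..1} \<eta> > 0"
    by (rule smooth_ramp) (rule that)
  \<comment> \<open>Mollification of \<open>D\<close> at scale \<epsilon>, written after rescaling
    so that \<epsilon> = 0 is allowed and gives a positive multiple of \<open>D x\<close>.\<close>
  define K where "K x \<epsilon> = integral {0..1} (\<lambda>t. \<eta> t * D (x + \<epsilon> * t))" for x \<epsilon>
  have K_cont: "continuous_on UNIV (K x)" for x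
    unfolding K_def
    by (rule integral_param_continuous)
      (auto simp: split_def intro!: continuous_intros continuous_on_compose2[OF D]
        continuous_on_compose2[OF smooth_imp_continuous_on[OF \<Theta>(4), of UNIV]])
  have K0: "K x 0 = integral {0..1} \<eta> * D x" for x
    by (simp add: K_def)
  \<comment> \<open>The chord through the values at 2 and 3; any two points beyond 1 would serve as
    anchors. The weights 3 - r, r - 2, -1 at 2, 3, r annihilate every affine function.\<close>
  have three: "D r = (3 - r) * D 2 + (r - 2) * D 3" if r: "r > 1" for r
  proof -
    define N where "N \<epsilon> = (3 - r) * K 2 \<epsilon> + (r - 2) * K 3 \<epsilon> - K r \<epsilon>" for \<epsilon>
    have N: "N \<epsilon> = 0" if \<epsilon>: "\<epsilon> \<in> {0<..<1}" for \<epsilon>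
    proof -
      have \<epsilon>0: "\<epsilon> > 0" "\<epsilon> < 1" using \<epsilon> by auto
      have aff: "((\<lambda>y. f ((1 / \<epsilon>) * y + (- x / \<epsilon>))) has_real_derivative (1 / \<epsilon>) * f' ((1 / \<epsilon>) * y + (- x / \<epsilon>))) (at y)"
        if "\<And>x. (f has_real_derivative f' x) (at x)" for f f' x y
      proof -
        have "((\<lambda>y. (1 / \<epsilon>) * y + (- x / \<epsilon>)) has_real_derivative 1 / \<epsilon>) (at y)"
          using \<epsilon>0 by (auto intro!: derivative_eq_intros)
        from DERIV_chain2[OF that this] show ?thesis by (simp add: mult.commute)
      qed
      \<comment> \<open>The same three weights applied to copies of \<open>f\<close> rescaled to
        width \<epsilon> at 2, 3 and r. For the ramp, the affine parts cancel to the right of all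
        three points, so \<open>s \<Theta>\<close> has compact support in r > 1; two derivatives
        turn it into \<open>s \<eta>\<close> up to a factor.\<close>
      define s where "s f y = (3 - r) * f ((1 / \<epsilon>) * y + (- 2 / \<epsilon>)) + (r - 2) * f ((1 / \<epsilon>) * y + (- 3 / \<epsilon>))
          + (- 1) * f ((1 / \<epsilon>) * y + (- r / \<epsilon>))" for f :: "real \<Rightarrow> real" and y
      have s_DERIV: "(s f has_real_derivative (1 / \<epsilon>) * s f' y) (at y)"
        if "\<And>x. (f has_real_derivative f' x) (at x)" for f f' y
      proof -
        have "(s f has_real_derivative (3 - r) * ((1 / \<epsilon>) * f' ((1 / \<epsilon>) * y + (- 2 / \<epsilon>)))
            + (r - 2) * ((1 / \<epsilon>) * f' ((1 / \<epsilon>) * y + (- 3 / \<epsilon>)))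
            + (- 1) * ((1 / \<epsilon>) * f' ((1 / \<epsilon>) * y + (- r / \<epsilon>)))) (at y)"
          unfolding s_def[abs_def] by (intro DERIV_add DERIV_cmult aff that)
        then show ?thesis by (simp only: s_def distrib_left mult.left_commute)
      qed
      have "smooth (s \<Theta>)"
        unfolding s_def[abs_def] by (intro smooth_add smooth_mult smooth_const smooth_affine \<Theta>(1))
      moreover have "1 < min 2 r" using r by simp
      moreover have "s \<Theta> y = 0" if "y \<notin> {min 2 r..max 3 r + 1}" for y
      proof -
        have e: "(1 / \<epsilon>) * y + (- x / \<epsilon>) = (y - x) / \<epsilon>" for x by (simp add: diff_divide_distrib)
        show ?thesis
        proof (cases "y < min 2 r")
          case True
          then have "(y - 2) / \<epsilon> \<le> 0" "(y - 3) / \<epsilon> \<le> 0" "(y - r) / \<epsilon> \<le> 0"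
            using \<epsilon>0 by (auto intro!: divide_nonpos_pos)
          then show ?thesis unfolding s_def e using \<Theta>(5) by simp
        next
          case False
          with that have "y > max 3 r + 1" by auto
          then have "(y - 2) / \<epsilon> \<ge> 1" "(y - 3) / \<epsilon> \<ge> 1" "(y - r) / \<epsilon> \<ge> 1"
            using \<epsilon>0 by (auto simp: field_simps)
          then have "s \<Theta> y = (3 - r) * (c + m * ((y - 2) / \<epsilon>)) + (r - 2) * (c + m * ((y - 3) / \<epsilon>))
              + (- 1) * (c + m * ((y - r) / \<epsilon>))"
            unfolding s_def e using \<Theta>(6) by simp
          also have "\<dots> = 0" using \<epsilon>0 by (simp add: field_simps)
          finally show ?thesis .
        qed
      qed
      ultimately have "(LBINT y. deriv (deriv (s \<Theta>)) y * D y) = 0" by (rule weak)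
      moreover have "deriv (s \<Theta>) = (\<lambda>y. (1 / \<epsilon>) * s H y)"
        by (intro ext DERIV_imp_deriv s_DERIV \<Theta>(2))
      moreover have "deriv (\<lambda>y. (1 / \<epsilon>) * s H y) = (\<lambda>y. (1 / \<epsilon>) * ((1 / \<epsilon>) * s \<eta> y))"
        by (intro ext DERIV_imp_deriv DERIV_cmult s_DERIV \<Theta>(3))
      ultimately have "(LBINT y. (1 / \<epsilon>) * ((1 / \<epsilon>) * s \<eta> y) * D y) = 0" by simp
      then have "(LBINT y. (1 / \<epsilon>)\<^sup>2 * (s \<eta> y * D y)) = 0" by (simp add: power2_eq_square mult_ac)
      then have s0: "(LBINT y. s \<eta> y * D y) = 0" using \<epsilon>0 by simp
      define T where "T x y = \<eta> ((1 / \<epsilon>) * y + (- x / \<epsilon>)) * D y" for x y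
      have T_int: "integrable lborel (T x)" for x
      proof (rule lborel_integral_compact_support(1)[of x "x + \<epsilon>"])
        show "continuous_on {x..x + \<epsilon>} (T x)"
          unfolding T_def
          by (intro continuous_intros continuous_on_compose2[OF D]
            continuous_on_compose2[OF smooth_imp_continuous_on[OF \<Theta>(4), of UNIV]]) auto
        show "T x y = 0" if "y \<notin> {x..x + \<epsilon>}" for y
        proof -
          have "(1 / \<epsilon>) * y + (- x / \<epsilon>) \<notin> {0..1}" using that \<epsilon>0 by (auto simp: field_simps)
          from \<Theta>(7)[OF this] show ?thesis unfolding T_def by simp
        qed
      qed
      have T_K: "(LBINT y. T x y) = \<epsilon> * K x \<epsilon>" for x
      proof -
        have "(LBINT y. T x y) = \<bar>\<epsilon>\<bar> *\<^sub>R (LBINT t. T x (x + \<epsilon> * t))"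
          using \<epsilon>0 by (intro lborel_integral_real_affine) auto
        also have "(\<lambda>t. T x (x + \<epsilon> * t)) = (\<lambda>t. \<eta> t * D (x + \<epsilon> * t))"
          using \<epsilon>0 by (simp add: T_def field_simps)
        also have "(LBINT t. \<eta> t * D (x + \<epsilon> * t)) = K x \<epsilon>"
          unfolding K_def
          by (rule lborel_integral_compact_support(2))
            (auto simp: \<Theta>(7) intro!: continuous_intros continuous_on_compose2[OF D]
              continuous_on_compose2[OF smooth_imp_continuous_on[OF \<Theta>(4), of UNIV]])
        finally show ?thesis using \<epsilon>0 by simp
      qed
      have "(LBINT y. s \<eta> y * D y) = (LBINT y. (3 - r) * T 2 y + (r - 2) * T 3 y - T r y)"
        by (simp add: s_def T_def algebra_simps)
      also have "\<dots> = (3 - r) * (\<epsilon> * K 2 \<epsilon>) + (r - 2) * (\<epsilon> * K 3 \<epsilon>) - \<epsilon> * K r \<epsilon>"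
        by (simp add: T_int T_K)
      also have "\<dots> = \<epsilon> * N \<epsilon>" by (simp add: N_def algebra_simps)
      finally show ?thesis using s0 \<epsilon>0 by simp
    qed
    have "N 0 = 0"
    proof (rule continuous_constant_on_closure[of "{0<..<1}" N])
      show "continuous_on (closure {0<..<1}) N"
        unfolding N_def by (intro continuous_intros continuous_on_subset[OF K_cont]) auto
    qed (use N in auto)
    then have "integral {0..1} \<eta> * ((3 - r) * D 2 + (r - 2) * D 3 - D r) = 0"
      by (simp add: N_def K0 algebra_simps)
    then show ?thesis using \<Theta>(8) by simp
  qed
  \<comment> \<open>Continuity adds the endpoint r = 1, which is where the data of the
    representation are taken.\<close>
  have "D r - ((3 - r) * D 2 + (r - 2) * D 3) = 0" if "r \<ge> 1" for r
  proof (rule continuous_constant_on_closure[of "{1<..}" "\<lambda>r. D r - ((3 - r) * D 2 + (r - 2) * D 3)"])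
    show "continuous_on (closure {1<..}) (\<lambda>r. D r - ((3 - r) * D 2 + (r - 2) * D 3))"
      by (intro continuous_intros continuous_on_subset[OF D]) auto
    show "D x - ((3 - x) * D 2 + (x - 2) * D 3) = 0" if "x \<in> {1<..}" for x
      using three[of x] that by simp
  qed (use that in auto)
  then have "D r = (3 * D 2 - 2 * D 3) + (D 3 - D 2) * r" if "r \<ge> 1" for r
    using that by (simp add: algebra_simps)
  then show ?thesis by (rule that)
qed

section \<open>The Klein-Gordon propagator\<close>

lemma continuous_on_besselC [continuous_intros]:
  assumes "continuous_on S f"
  shows "continuous_on S (\<lambda>x. besselC n (f x))"
proof (rule continuous_on_compose2[OF _ assms])
  show "continuous_on UNIV (besselC n)"
    by (meson DERIV_continuous_on DERIV_besselC has_field_derivative_at_within)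
qed auto

lemma smooth_continuous_compose:
  assumes "smooth \<psi>" "continuous_on S f"
  shows "continuous_on S (\<lambda>x. \<psi> (f x))"
  by (rule continuous_on_compose2[OF smooth_imp_continuous_on[OF assms(1), of UNIV] assms(2)]) auto

text \<open>Averages over the light cone \<open>{v - \<tau>..v + \<tau>}\<close>, rescaled to a fixed interval so that the dependence on
  \<open>\<tau>\<close> (of either sign) is smooth.\<close>

definition bmean :: "(real \<Rightarrow> real) \<Rightarrow> nat \<Rightarrow> (real \<Rightarrow> real) \<Rightarrow> real \<Rightarrow> real \<Rightarrow> real" where
  "bmean \<kappa> n \<psi> \<tau> v = integral {-1..1} (\<lambda>s. \<kappa> s * besselC n (\<tau>\<^sup>2 * (1 - s\<^sup>2) / 16) * \<psi> (v + \<tau> * s))"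

lemma bmean_integrand_continuous:
  assumes "continuous_on UNIV \<kappa>" "smooth \<psi>"
    and "continuous_on S t" "continuous_on S v" "continuous_on S s"
  shows "continuous_on S (\<lambda>x. \<kappa> (s x) * besselC n ((t x)\<^sup>2 * (1 - (s x)\<^sup>2) / 16) * \<psi> (v x + t x * s x))"
  by (intro continuous_intros smooth_continuous_compose[OF assms(2)] assms(3-)
      continuous_on_compose2[OF assms(1)]) auto

lemma bmean_integrable:
  assumes "continuous_on UNIV \<kappa>" "smooth \<psi>"
  shows "(\<lambda>s. \<kappa> s * besselC n (\<tau>\<^sup>2 * (1 - s\<^sup>2) / 16) * \<psi> (v + \<tau> * s)) integrable_on {a..b}"
  by (intro integrable_continuous_real bmean_integrand_continuous assms continuous_intros)

lemma bmean_continuous: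
  assumes "continuous_on UNIV \<kappa>" "smooth \<psi>" "continuous_on S t" "continuous_on S v"
  shows "continuous_on S (\<lambda>x. bmean \<kappa> n \<psi> (t x) (v x))"
  unfolding bmean_def
proof (rule integral_param_continuous)
  have "continuous_on (S \<times> {- 1..1}) (\<lambda>y. \<kappa> (snd y) * besselC n ((t (fst y))\<^sup>2 * (1 - (snd y)\<^sup>2) / 16)
      * \<psi> (v (fst y) + t (fst y) * snd y))"
    by (intro bmean_integrand_continuous assms(1,2) continuous_intros
        continuous_on_compose2[OF assms(3)] continuous_on_compose2[OF assms(4)]) auto
  then show "continuous_on (S \<times> {- 1..1}) (\<lambda>(x, s). \<kappa> s * besselC n ((t x)\<^sup>2 * (1 - s\<^sup>2) / 16)
      * \<psi> (v x + t x * s))"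
    by (simp add: split_def)
qed

lemma bmean_add:
  assumes "continuous_on UNIV \<kappa>" "continuous_on UNIV \<kappa>'" "smooth \<psi>"
  shows "bmean (\<lambda>s. \<kappa> s + \<kappa>' s) n \<psi> \<tau> v = bmean \<kappa> n \<psi> \<tau> v + bmean \<kappa>' n \<psi> \<tau> v"
  unfolding bmean_def
  by (simp only: distrib_right integral_add[OF bmean_integrable[OF assms(1,3)] bmean_integrable[OF assms(2,3)]])

lemma bmean_support:
  assumes "\<And>x. \<bar>x\<bar> > R \<Longrightarrow> \<psi> x = 0" "\<bar>v\<bar> > R + \<bar>\<tau>\<bar>"
  shows "bmean \<kappa> n \<psi> \<tau> v = 0"
proof -
  have "\<kappa> s * besselC n (\<tau>\<^sup>2 * (1 - s\<^sup>2) / 16) * \<psi> (v + \<tau> * s) = 0" if "s \<in> {-1..1}" for s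
  proof -
    have "\<bar>\<tau> * s\<bar> \<le> \<bar>\<tau>\<bar>" unfolding abs_mult using that by (intro mult_left_le) auto
    then have "\<bar>v + \<tau> * s\<bar> > R" using assms(2) by linarith
    then show ?thesis using assms(1) by simp
  qed
  then have "bmean \<kappa> n \<psi> \<tau> v = integral {-1..1} (\<lambda>s::real. 0)"
    unfolding bmean_def by (intro integral_cong) simp
  then show ?thesis by simp
qed

lemma leibniz_interval:
  fixes f :: "real \<Rightarrow> real \<Rightarrow> real"
  assumes "\<And>x t. ((\<lambda>x. f x t) has_real_derivative fx x t) (at x)"
    and "\<And>x. f x integrable_on {a..b}"
    and "continuous_on (UNIV \<times> {a..b}) (\<lambda>y. fx (fst y) (snd y))"
  shows "((\<lambda>x. integral {a..b} (f x)) has_real_derivative integral {a..b} (fx x)) (at x)"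
  using leibniz_rule_field_derivative[of UNIV a b f fx x] assms by (simp add: split_def)

lemma DERIV_bmean_v:
  assumes "continuous_on UNIV \<kappa>" "smooth \<psi>"
  shows "((\<lambda>v. bmean \<kappa> n \<psi> \<tau> v) has_real_derivative bmean \<kappa> n (deriv \<psi>) \<tau> v) (at v)"
  unfolding bmean_def
proof (rule leibniz_interval)
  show "((\<lambda>v. \<kappa> s * besselC n (\<tau>\<^sup>2 * (1 - s\<^sup>2) / 16) * \<psi> (v + \<tau> * s)) has_real_derivative
      \<kappa> s * besselC n (\<tau>\<^sup>2 * (1 - s\<^sup>2) / 16) * deriv \<psi> (v + \<tau> * s)) (at v)" for v s
  proof (rule DERIV_cmult)
    have "((\<lambda>v. v + \<tau> * s) has_real_derivative 1) (at v)"
      by (auto intro!: derivative_eq_intros)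
    from DERIV_chain2[OF smooth_DERIV[OF assms(2)] this]
    show "((\<lambda>v. \<psi> (v + \<tau> * s)) has_real_derivative deriv \<psi> (v + \<tau> * s)) (at v)" by simp
  qed
qed (intro bmean_integrable bmean_integrand_continuous assms smooth_deriv continuous_intros)+

text \<open>Differentiating the Bessel factor raises the index and brings down 1 - s^2;
  differentiating the translate brings down s. This is why weight and index are parameters of
  \<open>bmean\<close>.\<close>

lemma DERIV_bmean_tau:
  assumes "continuous_on UNIV \<kappa>" "smooth \<psi>"
  shows "((\<lambda>\<tau>. bmean \<kappa> n \<psi> \<tau> v) has_real_derivative
    \<tau> / 8 * bmean (\<lambda>s. \<kappa> s * (1 - s\<^sup>2)) (Suc n) \<psi> \<tau> v + bmean (\<lambda>s. \<kappa> s * s) n (deriv \<psi>) \<tau> v) (at \<tau>)"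
proof -
  let ?c = "\<lambda>n \<tau> s. besselC n (\<tau>\<^sup>2 * (1 - s\<^sup>2) / 16)"
  let ?f1 = "\<lambda>\<tau> s. \<kappa> s * (1 - s\<^sup>2) * ?c (Suc n) \<tau> s * \<psi> (v + \<tau> * s)"
  let ?f2 = "\<lambda>\<tau> s. \<kappa> s * s * ?c n \<tau> s * deriv \<psi> (v + \<tau> * s)"
  have \<kappa>1: "continuous_on UNIV (\<lambda>s. \<kappa> s * (1 - s\<^sup>2))" and \<kappa>2: "continuous_on UNIV (\<lambda>s. \<kappa> s * s)"
    by (intro continuous_intros assms(1))+
  have "((\<lambda>\<tau>. bmean \<kappa> n \<psi> \<tau> v) has_real_derivative integral {-1..1} (\<lambda>s. \<tau> / 8 * ?f1 \<tau> s + ?f2 \<tau> s)) (at \<tau>)"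
    unfolding bmean_def
  proof (rule leibniz_interval)
    show "((\<lambda>\<tau>. \<kappa> s * ?c n \<tau> s * \<psi> (v + \<tau> * s)) has_real_derivative \<tau> / 8 * ?f1 \<tau> s + ?f2 \<tau> s) (at \<tau>)" for \<tau> s
    proof -
      have "((\<lambda>\<tau>. v + \<tau> * s) has_real_derivative s) (at \<tau>)"
        by (auto intro!: derivative_eq_intros)
      note 1 = DERIV_chain2[OF smooth_DERIV[OF assms(2)] this]
      have "((\<lambda>\<tau>. \<tau>\<^sup>2 * (1 - s\<^sup>2) / 16) has_real_derivative \<tau> * (1 - s\<^sup>2) / 8) (at \<tau>)"
        by (auto intro!: derivative_eq_intros)
      note 2 = DERIV_chain2[OF DERIV_besselC this]
      from DERIV_mult[OF DERIV_cmult[OF 2, of "\<kappa> s"] 1] show ?thesis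
        by (rule DERIV_cong) (simp add: add_divide_distrib diff_divide_distrib algebra_simps)
    qed
    show "continuous_on (UNIV \<times> {- 1..1}) (\<lambda>y. fst y / 8 * ?f1 (fst y) (snd y) + ?f2 (fst y) (snd y))"
      by (rule continuous_on_add[OF continuous_on_mult[OF _ bmean_integrand_continuous[OF \<kappa>1 assms(2)]]
          bmean_integrand_continuous[OF \<kappa>2 smooth_deriv[OF assms(2)]]]) (intro continuous_intros; simp)+
  qed (rule bmean_integrable[OF assms])
  moreover have "integral {-1..1} (\<lambda>s. \<tau> / 8 * ?f1 \<tau> s + ?f2 \<tau> s)
      = \<tau> / 8 * integral {-1..1} (?f1 \<tau>) + integral {-1..1} (?f2 \<tau>)"
    by (simp only: integral_mult_right integral_add[OF
          integrable_on_mult_right[OF bmean_integrable[OF \<kappa>1 assms(2)]]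
          bmean_integrable[OF \<kappa>2 smooth_deriv[OF assms(2)]]])
  ultimately show ?thesis by (simp add: bmean_def)
qed

text \<open>Bessel's equation \<open>besselC_recurrence\<close> at z = \<tau>^2 (1 - s^2) / 16,
  integrated against \<psi>.\<close>

lemma bmean_recurrence:
  assumes "smooth \<psi>"
  shows "bmean (\<lambda>_. 1) 1 \<psi> \<tau> v + \<tau>\<^sup>2 / 16 * bmean (\<lambda>s. 1 - s\<^sup>2) 2 \<psi> \<tau> v = bmean (\<lambda>_. 1) 0 \<psi> \<tau> v"
proof -
  let ?z = "\<lambda>s. \<tau>\<^sup>2 * (1 - s\<^sup>2) / 16"
  have c: "continuous_on UNIV (\<lambda>s::real. 1 - s\<^sup>2)" "continuous_on UNIV (\<lambda>s::real. 1 :: real)"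
    by (intro continuous_intros)+
  have "bmean (\<lambda>_. 1) 1 \<psi> \<tau> v + \<tau>\<^sup>2 / 16 * bmean (\<lambda>s. 1 - s\<^sup>2) 2 \<psi> \<tau> v
      = integral {-1..1} (\<lambda>s. 1 * besselC 1 (?z s) * \<psi> (v + \<tau> * s)
          + \<tau>\<^sup>2 / 16 * ((1 - s\<^sup>2) * besselC 2 (?z s) * \<psi> (v + \<tau> * s)))"
    unfolding bmean_def by (simp only: integral_mult_right integral_add[OF bmean_integrable[OF c(2) assms]
      integrable_on_mult_right[OF bmean_integrable[OF c(1) assms]]])
  also have "\<dots> = bmean (\<lambda>_. 1) 0 \<psi> \<tau> v"
    unfolding bmean_def
  proof (rule integral_cong)
    show "1 * besselC 1 (?z s) * \<psi> (v + \<tau> * s) + \<tau>\<^sup>2 / 16 * ((1 - s\<^sup>2) * besselC 2 (?z s) * \<psi> (v + \<tau> * s))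
        = 1 * besselC 0 (?z s) * \<psi> (v + \<tau> * s)" for s
      unfolding besselC_recurrence[of "?z s", symmetric]
      by (simp add: add_divide_distrib diff_divide_distrib algebra_simps)
  qed
  finally show ?thesis .
qed

text \<open>The fundamental theorem applied to \<open>\<kappa>\<close> times the index 0 Bessel
  factor times the translate of \<psi>. The weight s serves to compute the first time derivative of
  \<open>kg\<close>, the weight 1 the second.\<close>

lemma bmean_by_parts:
  assumes "smooth \<psi>" and \<kappa>: "\<And>s. (\<kappa> has_real_derivative \<kappa>' s) (at s)" and \<kappa>': "continuous_on UNIV \<kappa>'"
  shows "bmean \<kappa>' 0 \<psi> \<tau> v + \<tau> * bmean \<kappa> 0 (deriv \<psi>) \<tau> v
    = \<kappa> 1 * \<psi> (v + \<tau>) - \<kappa> (-1) * \<psi> (v - \<tau>) + \<tau>\<^sup>2 / 8 * bmean (\<lambda>s. \<kappa> s * s) 1 \<psi> \<tau> v"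
proof -
  let ?c = "\<lambda>n s. besselC n (\<tau>\<^sup>2 * (1 - s\<^sup>2) / 16)"
  let ?g1 = "\<lambda>s. \<kappa>' s * ?c 0 s * \<psi> (v + \<tau> * s)"
  let ?g2 = "\<lambda>s. \<kappa> s * ?c 0 s * deriv \<psi> (v + \<tau> * s)"
  let ?g3 = "\<lambda>s. \<kappa> s * s * ?c 1 s * \<psi> (v + \<tau> * s)"
  have \<kappa>c: "continuous_on UNIV \<kappa>"
    by (meson DERIV_continuous_on \<kappa> has_field_derivative_at_within)
  have \<kappa>sc: "continuous_on UNIV (\<lambda>s. \<kappa> s * s)"
    by (intro continuous_intros \<kappa>c)
  have d: "((\<lambda>s. \<kappa> s * ?c 0 s * \<psi> (v + \<tau> * s)) has_real_derivative
      (?g1 s + \<tau> * ?g2 s) + (- (\<tau>\<^sup>2 / 8)) * ?g3 s) (at s)" for s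
  proof -
    have "((\<lambda>s. v + \<tau> * s) has_real_derivative \<tau>) (at s)"
      by (auto intro!: derivative_eq_intros)
    note 1 = DERIV_chain2[OF smooth_DERIV[OF assms(1)] this]
    have "((\<lambda>s. \<tau>\<^sup>2 * (1 - s\<^sup>2) / 16) has_real_derivative - (\<tau>\<^sup>2 * s / 8)) (at s)"
      by (auto intro!: derivative_eq_intros)
    note 2 = DERIV_chain2[OF DERIV_besselC this]
    from DERIV_mult[OF DERIV_mult[OF \<kappa> 2] 1] show ?thesis
      by (rule DERIV_cong) (simp add: add_divide_distrib diff_divide_distrib algebra_simps)
  qed
  have i1: "?g1 integrable_on {-1..1}" by (rule bmean_integrable[OF \<kappa>' assms(1)])
  have i2: "(\<lambda>s. \<tau> * ?g2 s) integrable_on {-1..1}"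
    by (rule integrable_on_mult_right[OF bmean_integrable[OF \<kappa>c smooth_deriv[OF assms(1)]]])
  have i3: "(\<lambda>s. (- (\<tau>\<^sup>2 / 8)) * ?g3 s) integrable_on {-1..1}"
    by (rule integrable_on_mult_right[OF bmean_integrable[OF \<kappa>sc assms(1)]])
  have hi: "((\<lambda>s. (?g1 s + \<tau> * ?g2 s) + (- (\<tau>\<^sup>2 / 8)) * ?g3 s) has_integral
      \<kappa> 1 * ?c 0 1 * \<psi> (v + \<tau> * 1) - \<kappa> (-1) * ?c 0 (-1) * \<psi> (v + \<tau> * (-1))) {-1..1}"
    by (rule fundamental_theorem_of_calculus)
      (use d in \<open>auto simp: has_real_derivative_iff_has_vector_derivative[symmetric]
        intro: has_field_derivative_at_within\<close>)
  have sum: "integral {-1..1} (\<lambda>s. (?g1 s + \<tau> * ?g2 s) + (- (\<tau>\<^sup>2 / 8)) * ?g3 s)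
      = integral {-1..1} ?g1 + \<tau> * integral {-1..1} ?g2 + (- (\<tau>\<^sup>2 / 8)) * integral {-1..1} ?g3"
    by (simp only: integral_add[OF integrable_add[OF i1 i2] i3] integral_add[OF i1 i2] integral_mult_right)
  \<comment> \<open>At s = -1 and s = 1 the Bessel argument is 0, and only the term m = 0 survives,
    with 0 ^ 0 = 1; the endpoint values thus carry no Bessel factor.\<close>
  have c0: "besselC 0 0 = 1"
    using suminf_finite[of "{0::nat}" "\<lambda>m. 0 ^ m / (fact m * fact (m + 0)) :: real"]
    by (simp add: besselC_def)
  have "integral {-1..1} ?g1 + \<tau> * integral {-1..1} ?g2 + (- (\<tau>\<^sup>2 / 8)) * integral {-1..1} ?g3
      = \<kappa> 1 * \<psi> (v + \<tau>) - \<kappa> (-1) * \<psi> (v - \<tau>)"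
    using sum[symmetric] integral_unique[OF hi] by (simp add: c0)
  then show ?thesis unfolding bmean_def by linarith
qed

text \<open>\<open>kg \<psi>\<close> solves \<open>u_tt = u_vv + u / 4\<close> with initial value 0 and initial velocity \<open>\<psi>\<close>; \<open>kg_t \<psi>\<close> is its
  \<open>\<tau>\<close>-derivative after an integration by parts.\<close>

definition kg :: "(real \<Rightarrow> real) \<Rightarrow> real \<Rightarrow> real \<Rightarrow> real" where
  "kg \<psi> \<tau> v = \<tau> / 2 * bmean (\<lambda>_. 1) 0 \<psi> \<tau> v"

definition kg_t :: "(real \<Rightarrow> real) \<Rightarrow> real \<Rightarrow> real \<Rightarrow> real" where
  "kg_t \<psi> \<tau> v = (\<psi> (v + \<tau>) + \<psi> (v - \<tau>)) / 2 + \<tau>\<^sup>2 / 16 * bmean (\<lambda>_. 1) 1 \<psi> \<tau> v"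

lemma DERIV_kg_v:
  assumes "smooth \<psi>"
  shows "((\<lambda>v. kg \<psi> \<tau> v) has_real_derivative kg (deriv \<psi>) \<tau> v) (at v)"
  unfolding kg_def by (intro DERIV_cmult DERIV_bmean_v assms continuous_intros)

text \<open>Integration by parts with weight s trades the averages of \<psi> and of s times its
  derivative for the endpoint values and an index 1 average with weight s^2. The latter joins the
  one with weight 1 - s^2 from the Bessel factor, and the weights add up to 1.\<close>

lemma DERIV_kg:
  assumes "smooth \<psi>"
  shows "((\<lambda>\<tau>. kg \<psi> \<tau> v) has_real_derivative kg_t \<psi> \<tau> v) (at \<tau>)"
proof -
  have "((\<lambda>\<tau>. \<tau> / 2 * bmean (\<lambda>_. 1) 0 \<psi> \<tau> v) has_real_derivative
      1 / 2 * bmean (\<lambda>_. 1) 0 \<psi> \<tau> v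
      + (\<tau> / 8 * bmean (\<lambda>s. 1 * (1 - s\<^sup>2)) (Suc 0) \<psi> \<tau> v + bmean (\<lambda>s. 1 * s) 0 (deriv \<psi>) \<tau> v) * (\<tau> / 2)) (at \<tau>)"
    by (intro DERIV_mult DERIV_bmean_tau assms continuous_intros) (auto intro!: derivative_eq_intros)
  moreover have "bmean (\<lambda>_. 1) 0 \<psi> \<tau> v + \<tau> * bmean (\<lambda>s. s) 0 (deriv \<psi>) \<tau> v
      = \<psi> (v + \<tau>) + \<psi> (v - \<tau>) + \<tau>\<^sup>2 / 8 * bmean (\<lambda>s. s\<^sup>2) 1 \<psi> \<tau> v"
    using bmean_by_parts[OF assms, of "\<lambda>s. s" "\<lambda>_. 1" \<tau> v] by (simp add: power2_eq_square)
  moreover have "bmean (\<lambda>_. 1) 1 \<psi> \<tau> v = bmean (\<lambda>s. s\<^sup>2) 1 \<psi> \<tau> v + bmean (\<lambda>s. 1 - s\<^sup>2) 1 \<psi> \<tau> v"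
    using bmean_add[of "\<lambda>s. s\<^sup>2" "\<lambda>s. 1 - s\<^sup>2" \<psi> 1 \<tau> v] assms by (simp add: continuous_intros)
  ultimately have "((\<lambda>\<tau>. \<tau> / 2 * bmean (\<lambda>_. 1) 0 \<psi> \<tau> v) has_real_derivative kg_t \<psi> \<tau> v) (at \<tau>)"
    by (elim DERIV_cong) (simp add: kg_t_def power2_eq_square add_divide_distrib diff_divide_distrib algebra_simps)
  then show ?thesis by (simp add: kg_def)
qed

text \<open>Integration by parts with weight 1 gathers the terms containing
  \<open>deriv \<psi>\<close> into the propagator of the second derivative; Bessel's equation turns
  the remaining index 1 and 2 averages into \<open>kg \<psi> / 4\<close>.\<close>

lemma DERIV_kg_t:
  assumes "smooth \<psi>"
  shows "((\<lambda>\<tau>. kg_t \<psi> \<tau> v) has_real_derivative kg (deriv (deriv \<psi>)) \<tau> v + kg \<psi> \<tau> v / 4) (at \<tau>)"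
proof -
  have 1: "((\<lambda>\<tau>. \<psi> (v + \<tau>)) has_real_derivative deriv \<psi> (v + \<tau>) * 1) (at \<tau>)"
    by (rule DERIV_chain2[OF smooth_DERIV[OF assms]]) (auto intro!: derivative_eq_intros)
  have 2: "((\<lambda>\<tau>. \<psi> (v - \<tau>)) has_real_derivative deriv \<psi> (v - \<tau>) * (-1)) (at \<tau>)"
    by (rule DERIV_chain2[OF smooth_DERIV[OF assms]]) (auto intro!: derivative_eq_intros)
  have 3: "((\<lambda>\<tau>. \<tau>\<^sup>2 / 16 * bmean (\<lambda>_. 1) 1 \<psi> \<tau> v) has_real_derivative
      \<tau> / 8 * bmean (\<lambda>_. 1) 1 \<psi> \<tau> v
      + (\<tau> / 8 * bmean (\<lambda>s. 1 * (1 - s\<^sup>2)) (Suc 1) \<psi> \<tau> v + bmean (\<lambda>s. 1 * s) 1 (deriv \<psi>) \<tau> v) * (\<tau>\<^sup>2 / 16)) (at \<tau>)"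
    by (intro DERIV_mult DERIV_bmean_tau assms continuous_intros) (auto intro!: derivative_eq_intros)
  have bp: "\<tau> * bmean (\<lambda>_. 1) 0 (deriv (deriv \<psi>)) \<tau> v
      = deriv \<psi> (v + \<tau>) - deriv \<psi> (v - \<tau>) + \<tau>\<^sup>2 / 8 * bmean (\<lambda>s. s) 1 (deriv \<psi>) \<tau> v"
    using bmean_by_parts[OF smooth_deriv[OF assms], of "\<lambda>_. 1" "\<lambda>_. 0" \<tau> v] by (simp add: bmean_def[of "\<lambda>_. 0"])
  have rec: "\<tau> * bmean (\<lambda>_. 1) 0 \<psi> \<tau> v
      = \<tau> * bmean (\<lambda>_. 1) 1 \<psi> \<tau> v + \<tau> * (\<tau>\<^sup>2 / 16 * bmean (\<lambda>s. 1 - s\<^sup>2) 2 \<psi> \<tau> v)"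
    by (subst bmean_recurrence[OF assms, symmetric]) (simp add: distrib_left)
  show ?thesis
    unfolding kg_t_def kg_def
    by (rule DERIV_cong[OF DERIV_add[OF DERIV_cdivide[OF DERIV_add[OF 1 2]] 3[unfolded Suc_1 mult_1]]], insert bp rec)
      (simp add: power2_eq_square add_divide_distrib diff_divide_distrib algebra_simps)
qed

section \<open>The convolution kernels in terms of the propagator\<close>

lemma lborel_integral_open_unit_interval:
  fixes F :: "real \<Rightarrow> real"
  assumes "continuous_on UNIV F"
  shows "(LBINT s. (if \<bar>s\<bar> < 1 then F s else 0)) = integral {-1..1} F"
proof -
  have [measurable]: "F \<in> borel_measurable borel"
    by (rule borel_measurable_continuous_onI[OF assms])
  have si: "set_integrable lborel {-1..1} F"
    by (rule borel_integrable_atLeastAtMost'[OF continuous_on_subset[OF assms]]) simp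
  have "(LBINT s. (if \<bar>s\<bar> < 1 then F s else 0)) = (LBINT s. indicator {-1..1} s *\<^sub>R F s)"
  proof (rule integral_cong_AE)
    have "AE s in lborel. s \<noteq> -1" "AE s in lborel. s \<noteq> (1::real)"
      by (rule AE_lborel_singleton)+
    then show "AE s in lborel. (if \<bar>s\<bar> < 1 then F s else 0) = indicator {-1..1} s *\<^sub>R F s"
      by eventually_elim (auto simp: indicator_def)
  qed measurable
  also have "\<dots> = integral {-1..1} F"
    using set_borel_integral_eq_integral(2)[OF si] by (simp add: set_lebesgue_integral_def)
  finally show ?thesis .
qed

lemma kernel_integral_rescale:
  fixes \<psi> F g :: "real \<Rightarrow> real"
  assumes "L > 0" "continuous_on UNIV \<psi>" "continuous_on UNIV F"
    and g: "\<And>s. g (L * s) = (if \<bar>s\<bar> < 1 then F s else 0)"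
  shows "(LBINT v. g (v - w) * \<psi> v) = L * integral {-1..1} (\<lambda>s. F s * \<psi> (w + L * s))"
proof -
  have "(LBINT v. g (v - w) * \<psi> v) = \<bar>L\<bar> *\<^sub>R (LBINT s. g (w + L * s - w) * \<psi> (w + L * s))"
    using assms(1) by (intro lborel_integral_real_affine) auto
  also have "(\<lambda>s. g (w + L * s - w) * \<psi> (w + L * s))
      = (\<lambda>s. if \<bar>s\<bar> < 1 then F s * \<psi> (w + L * s) else 0)"
    by (simp add: g fun_eq_iff)
  also have "(LBINT s. (if \<bar>s\<bar> < 1 then F s * \<psi> (w + L * s) else 0))
      = integral {-1..1} (\<lambda>s. F s * \<psi> (w + L * s))"
    by (intro lborel_integral_open_unit_interval continuous_intros assms(3)
        continuous_on_compose2[OF assms(2)]) auto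
  finally show ?thesis using assms(1) by simp
qed

text \<open>With x = sqrt(L^2 (1 - s^2)) / 2 one has x^2 / 4 = L^2 (1 - s^2) / 16, the origin of the
  16 in \<open>bmean\<close>. The prefactor x / 2 of \<open>besselI 1\<close> cancels the square
  root in the denominator, which is nonzero strictly inside the cone.\<close>

lemma besselI_sqrt:
  assumes "L > 0" "\<bar>s\<bar> < 1"
  shows "besselI 0 (sqrt (L\<^sup>2 - (L * s)\<^sup>2) / 2) = besselC 0 (L\<^sup>2 * (1 - s\<^sup>2) / 16)"
    and "L / sqrt (L\<^sup>2 - (L * s)\<^sup>2) * besselI 1 (sqrt (L\<^sup>2 - (L * s)\<^sup>2) / 2)
      = L / 4 * besselC 1 (L\<^sup>2 * (1 - s\<^sup>2) / 16)"
proof -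
  have e: "L\<^sup>2 - (L * s)\<^sup>2 = L\<^sup>2 * (1 - s\<^sup>2)" by (simp add: algebra_simps power_mult_distrib)
  have "s\<^sup>2 < 1" using assms(2) by (simp add: abs_square_less_1)
  then have pos: "L\<^sup>2 * (1 - s\<^sup>2) > 0" using assms(1) by simp
  then have sq: "(sqrt (L\<^sup>2 * (1 - s\<^sup>2)) / 2)\<^sup>2 / 4 = L\<^sup>2 * (1 - s\<^sup>2) / 16"
    by (simp add: power_divide)
  show "besselI 0 (sqrt (L\<^sup>2 - (L * s)\<^sup>2) / 2) = besselC 0 (L\<^sup>2 * (1 - s\<^sup>2) / 16)"
    by (simp only: e besselI_besselC sq) simp
  have "sqrt (L\<^sup>2 * (1 - s\<^sup>2)) \<noteq> 0" using pos by (metis less_irrefl real_sqrt_eq_0_iff)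
  then show "L / sqrt (L\<^sup>2 - (L * s)\<^sup>2) * besselI 1 (sqrt (L\<^sup>2 - (L * s)\<^sup>2) / 2)
      = L / 4 * besselC 1 (L\<^sup>2 * (1 - s\<^sup>2) / 16)"
    unfolding e besselI_besselC sq by (simp only: power_one_right) (simp add: divide_simps)
qed

lemma conv_sharp_eq:
  assumes "\<rho> \<ge> 1" "smooth \<psi>"
  shows "conv_sharp \<rho> \<psi> w = sqrt \<rho> * kg \<psi> (ln \<rho>) w"
\<comment> \<open>Here the cone is empty and cannot be rescaled to the unit interval, but both sides
  vanish.\<close>
proof (cases "\<rho> = 1")
  case True
  then show ?thesis by (simp add: conv_sharp_def chi_sharp_def kg_def)
next
  case False
  define L where "L = ln \<rho>"
  have L: "L > 0" using assms(1) False by (simp add: L_def)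
  define F where "F s = 1/2 * sqrt \<rho> * besselC 0 (L\<^sup>2 * (1 - s\<^sup>2) / 16)" for s
  have "(LBINT v. chi_sharp \<rho> (v - w) * \<psi> v) = L * integral {-1..1} (\<lambda>s. F s * \<psi> (w + L * s))"
  proof (rule kernel_integral_rescale[OF L])
    show "chi_sharp \<rho> (L * s) = (if \<bar>s\<bar> < 1 then F s else 0)" for s
      using L besselI_sqrt(1)[OF L, of s] by (simp add: chi_sharp_def F_def L_def[symmetric] abs_mult)
    show "continuous_on UNIV F" unfolding F_def by (intro continuous_intros) auto
  qed (rule smooth_imp_continuous_on[OF assms(2)])
  also have "(\<lambda>s. F s * \<psi> (w + L * s))
      = (\<lambda>s. (1/2 * sqrt \<rho>) * (1 * besselC 0 (L\<^sup>2 * (1 - s\<^sup>2) / 16) * \<psi> (w + L * s)))"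
    by (simp add: F_def mult_ac)
  also have "L * integral {-1..1} \<dots> = sqrt \<rho> * kg \<psi> L w"
    by (simp only: integral_mult_right kg_def bmean_def) simp
  finally show ?thesis by (simp add: conv_sharp_def L_def)
qed

text \<open>The Dirac part and the \<open>besselI 1\<close> term together form \<open>kg_t\<close>;
  the \<open>besselI 0\<close> term with coefficient -1/4 is half the propagator.\<close>

lemma conv_flat_eq:
  assumes "\<rho> \<ge> 1" "smooth \<psi>"
  shows "conv_flat \<rho> \<psi> w = sqrt \<rho> * (kg_t \<psi> (ln \<rho>) w - kg \<psi> (ln \<rho>) w / 2)"
proof (cases "\<rho> = 1")
  case True
  then show ?thesis by (simp add: conv_flat_def chi_flat_ac_def kg_def kg_t_def)
next
  case False
  define L where "L = ln \<rho>"
  have L: "L > 0" using assms(1) False by (simp add: L_def)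
  let ?c = "\<lambda>n s. besselC n (L\<^sup>2 * (1 - s\<^sup>2) / 16)"
  define F where "F s = - 1/4 * sqrt \<rho> * ?c 0 s + 1/4 * sqrt \<rho> * (L / 4 * ?c 1 s)" for s
  have i: "(\<lambda>s. 1 * ?c n s * \<psi> (w + L * s)) integrable_on {-1..1}" for n
    by (intro bmean_integrable assms(2) continuous_intros)
  have "(LBINT v. chi_flat_ac \<rho> (v - w) * \<psi> v) = L * integral {-1..1} (\<lambda>s. F s * \<psi> (w + L * s))"
  proof (rule kernel_integral_rescale[OF L])
    show "chi_flat_ac \<rho> (L * s) = (if \<bar>s\<bar> < 1 then F s else 0)" for s
    proof (cases "\<bar>s\<bar> < 1")
      case True
      then have "\<bar>L * s\<bar> < L" using L by (simp add: abs_mult)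
      with True show ?thesis
        unfolding F_def besselI_sqrt[OF L True, symmetric] chi_flat_ac_def L_def[symmetric] by simp
    next
      case False
      then have "\<not> \<bar>L * s\<bar> < L" using L by (simp add: abs_mult)
      with False show ?thesis by (simp add: chi_flat_ac_def L_def[symmetric])
    qed
    show "continuous_on UNIV F" unfolding F_def by (intro continuous_intros) auto
  qed (rule smooth_imp_continuous_on[OF assms(2)])
  also have "(\<lambda>s. F s * \<psi> (w + L * s))
      = (\<lambda>s. (- 1/4 * sqrt \<rho>) * (1 * ?c 0 s * \<psi> (w + L * s))
        + (1/4 * sqrt \<rho> * L / 4) * (1 * ?c 1 s * \<psi> (w + L * s)))"
    by (simp add: F_def algebra_simps)
  also have "L * integral {-1..1} \<dots>
      = L * ((- 1/4 * sqrt \<rho>) * bmean (\<lambda>_. 1) 0 \<psi> L w + (1/4 * sqrt \<rho> * L / 4) * bmean (\<lambda>_. 1) 1 \<psi> L w)"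
    by (simp only: integral_add[OF integrable_on_mult_right[OF i] integrable_on_mult_right[OF i]]
        integral_mult_right bmean_def)
  finally show ?thesis
    by (simp add: conv_flat_def L_def[symmetric] kg_def kg_t_def power2_eq_square add_divide_distrib diff_divide_distrib
        algebra_simps)
qed

lemma smooth_kg:
  assumes "smooth \<psi>"
  shows "smooth (kg \<psi> \<tau>)"
proof -
  have "Ck k (kg \<psi> \<tau>)" for k
    using assms
  proof (induction k arbitrary: \<psi>)
    case (Suc k)
    show ?case by (rule Ck_SucI[OF DERIV_kg_v[OF Suc.prems] Suc.IH[OF smooth_deriv[OF Suc.prems]]])
  qed simp
  then show ?thesis by (simp add: smooth_def)
qed

lemma kg_support:
  assumes "\<And>x. \<bar>x\<bar> > R \<Longrightarrow> \<psi> x = 0" "\<bar>v\<bar> > R + \<bar>\<tau>\<bar>"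
  shows "kg \<psi> \<tau> v = 0" "kg_t \<psi> \<tau> v = 0"
proof -
  have "\<bar>v + \<tau>\<bar> > R" "\<bar>v - \<tau>\<bar> > R" using assms(2) by linarith+
  then show "kg \<psi> \<tau> v = 0" "kg_t \<psi> \<tau> v = 0"
    by (simp_all add: kg_def kg_t_def assms(1) bmean_support[OF assms])
qed

lemma test1_kg:
  assumes "test1 \<psi>"
  shows "test1 (kg \<psi> \<tau>)"
proof -
  from assms obtain R where "smooth \<psi>" and R: "\<And>x. \<bar>x\<bar> > R \<Longrightarrow> \<psi> x = 0"
    by (auto simp: test1_iff)
  have "kg \<psi> \<tau> v = 0" if "\<bar>v\<bar> > R + \<bar>\<tau>\<bar>" for v
    by (rule kg_support(1)[OF R that])
  then show ?thesis
    unfolding test1_iff using smooth_kg[OF \<open>smooth \<psi>\<close>] by auto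
qed

lemma deriv_support:
  fixes a :: "real \<Rightarrow> real"
  assumes "closed S" "\<And>x. x \<notin> S \<Longrightarrow> a x = 0" "x \<notin> S"
  shows "deriv a x = 0"
proof (rule deriv_eq_0_of_eventually)
  have "open (- S)" using assms(1) by auto
  then show "\<forall>\<^sub>F y in nhds x. a y = 0"
    using assms(2,3) by (auto simp: eventually_nhds intro!: exI[of _ "- S"])
qed

lemma deriv_abs_support:
  fixes \<psi> :: "real \<Rightarrow> real"
  assumes "\<And>x. \<bar>x\<bar> > R \<Longrightarrow> \<psi> x = 0" "\<bar>x\<bar> > R"
  shows "deriv \<psi> x = 0"
proof (rule deriv_support)
  show "closed {x. \<bar>x\<bar> \<le> R}" by (intro closed_Collect_le continuous_intros)
qed (use assms in auto)

section \<open>Test functions built from the propagator\<close>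

text \<open>The shape that r-derivatives generate at time \<tau> = L - ln r: the chain rule gives
  powers of r, \<open>DERIV_bmean_tau\<close> gives powers of \<tau>, and the cutoff
  \<open>a\<close> confines everything to r > 0.\<close>

definition bmean_term where
  "bmean_term L a e i \<kappa> n \<psi> = (\<lambda>r v. a r * r powr e * (L - ln r) ^ i * bmean \<kappa> n \<psi> (L - ln r) v)"

text \<open>The span of the functions \<open>bmean_term\<close> is closed under both partial derivatives, so that
  first-order regularity of its members already makes them test functions.\<close>

inductive bmean_span for L \<alpha> \<beta> R :: real where
  bmean_span_term: "smooth a \<Longrightarrow> (\<And>r. r \<notin> {\<alpha>..\<beta>} \<Longrightarrow> a r = 0) \<Longrightarrow> smooth \<psi> \<Longrightarrow>
    (\<And>x. \<bar>x\<bar> > R \<Longrightarrow> \<psi> x = 0) \<Longrightarrow> continuous_on UNIV \<kappa> \<Longrightarrow> bmean_span L \<alpha> \<beta> R (bmean_term L a e i \<kappa> n \<psi>)"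
| bmean_span_add: "bmean_span L \<alpha> \<beta> R f \<Longrightarrow> bmean_span L \<alpha> \<beta> R g \<Longrightarrow> bmean_span L \<alpha> \<beta> R (\<lambda>r v. f r v + g r v)"

lemma bmean_span_support:
  assumes "bmean_span L \<alpha> \<beta> R f" "0 < \<alpha>" "f r v \<noteq> 0"
  shows "r \<in> {\<alpha>..\<beta>}" "\<bar>v\<bar> \<le> R + (\<bar>L\<bar> + \<bar>ln \<alpha>\<bar> + \<bar>ln \<beta>\<bar>)"
proof -
  have "r \<in> {\<alpha>..\<beta>} \<and> \<bar>v\<bar> \<le> R + (\<bar>L\<bar> + \<bar>ln \<alpha>\<bar> + \<bar>ln \<beta>\<bar>)"
    using assms(1,3)
  proof (induction rule: bmean_span.induct)
    case (bmean_span_term a \<psi> \<kappa> e i n)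
    have r: "r \<in> {\<alpha>..\<beta>}" using bmean_span_term by (auto simp: bmean_term_def)
    have "bmean \<kappa> n \<psi> (L - ln r) v \<noteq> 0" using bmean_span_term by (auto simp: bmean_term_def)
    moreover have "bmean \<kappa> n \<psi> (L - ln r) v = 0" if "\<bar>v\<bar> > R + \<bar>L - ln r\<bar>"
      by (rule bmean_support[OF bmean_span_term(4) that])
    ultimately have "\<bar>v\<bar> \<le> R + \<bar>L - ln r\<bar>" by linarith
    moreover have "ln \<alpha> \<le> ln r" "ln r \<le> ln \<beta>" using r assms(2) by auto
    ultimately show ?case using r by auto
  next
    case (bmean_span_add f g)
    then show ?case by (cases "f r v = 0") simp_all
  qed
  then show "r \<in> {\<alpha>..\<beta>}" "\<bar>v\<bar> \<le> R + (\<bar>L\<bar> + \<bar>ln \<alpha>\<bar> + \<bar>ln \<beta>\<bar>)" by auto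
qed

lemma bmean_span_continuous:
  assumes "bmean_span L \<alpha> \<beta> R f" "0 < \<alpha>"
  shows "continuous_on UNIV (\<lambda>(r, v). f r v)"
  using assms(1)
proof (induction rule: bmean_span.induct)
  case (bmean_span_term a \<psi> \<kappa> e i n)
  have "continuous_on ({0<..} \<times> UNIV) (\<lambda>(r, v). bmean_term L a e i \<kappa> n \<psi> r v)"
    unfolding bmean_term_def split_def
    by (intro continuous_intros bmean_continuous bmean_span_term smooth_continuous_compose[OF bmean_span_term(1)]) auto
  \<comment> \<open>Where \<open>ln\<close> and \<open>powr\<close> take only default values the
    cutoff is zero; the two overlapping open sets cover the plane.\<close>
  moreover have "continuous_on ({..<\<alpha>} \<times> UNIV) (\<lambda>(r, v). bmean_term L a e i \<kappa> n \<psi> r v)"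
  proof (rule continuous_on_eq)
    show "continuous_on ({..<\<alpha>} \<times> UNIV) (\<lambda>_. 0 :: real)" by (intro continuous_intros)
  qed (auto simp: bmean_term_def bmean_span_term(2))
  ultimately have "continuous_on ({0<..} \<times> UNIV \<union> {..<\<alpha>} \<times> UNIV) (\<lambda>(r, v). bmean_term L a e i \<kappa> n \<psi> r v)"
    by (intro continuous_on_open_Un open_Times) auto
  moreover have "{0<..} \<times> UNIV \<union> {..<\<alpha>} \<times> UNIV = (UNIV :: (real \<times> real) set)"
    using assms(2) by auto
  ultimately show ?case by simp
next
  case (bmean_span_add f g)
  then show ?case unfolding split_def by (intro continuous_intros)
qed

lemma bmean_span_DERIV_v:
  assumes "bmean_span L \<alpha> \<beta> R f"
  shows "\<exists>f'. bmean_span L \<alpha> \<beta> R f' \<and> (\<forall>r v. ((\<lambda>v. f r v) has_real_derivative f' r v) (at v))"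
  using assms
proof (induction rule: bmean_span.induct)
  case (bmean_span_term a \<psi> \<kappa> e i n)
  have "deriv \<psi> x = 0" if "\<bar>x\<bar> > R" for x
    by (rule deriv_abs_support[OF bmean_span_term(4) that])
  then have "bmean_span L \<alpha> \<beta> R (bmean_term L a e i \<kappa> n (deriv \<psi>))"
    using bmean_span_term by (intro bmean_span.bmean_span_term smooth_deriv)
  moreover have "((\<lambda>v. bmean_term L a e i \<kappa> n \<psi> r v) has_real_derivative bmean_term L a e i \<kappa> n (deriv \<psi>) r v) (at v)" for r v
    unfolding bmean_term_def by (intro DERIV_cmult DERIV_bmean_v bmean_span_term)
  ultimately show ?case by blast
next
  case (bmean_span_add f g)
  then obtain f' g' where
    f': "bmean_span L \<alpha> \<beta> R f'" "\<And>r v. ((\<lambda>v. f r v) has_real_derivative f' r v) (at v)" and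
    g': "bmean_span L \<alpha> \<beta> R g'" "\<And>r v. ((\<lambda>v. g r v) has_real_derivative g' r v) (at v)" by blast
  show ?case
    by (intro exI[of _ "\<lambda>r v. f' r v + g' r v"] conjI allI bmean_span.bmean_span_add DERIV_add f' g')
qed

lemma bmean_span_DERIV_r:
  assumes "bmean_span L \<alpha> \<beta> R f" "0 < \<alpha>"
  shows "\<exists>f'. bmean_span L \<alpha> \<beta> R f' \<and> (\<forall>r v. ((\<lambda>r. f r v) has_real_derivative f' r v) (at r))"
  using assms(1)
proof (induction rule: bmean_span.induct)
  case (bmean_span_term a \<psi> \<kappa> e i n)
  have \<psi>': "deriv \<psi> x = 0" if "\<bar>x\<bar> > R" for x
    by (rule deriv_abs_support[OF bmean_span_term(4) that])
  have a': "deriv a r = 0" if "r \<notin> {\<alpha>..\<beta>}" for r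
    using deriv_support[of "{\<alpha>..\<beta>}" a r] bmean_span_term(2) that by auto
  have sc: "smooth (\<lambda>r. c * a r)" for c by (intro smooth_mult smooth_const bmean_span_term(1))
  \<comment> \<open>One term for each factor of the product, two for the average. The span has no
    scaling rule, so scalars are absorbed into the cutoff. For i = 0 the truncated exponent
    \<open>i - 1\<close> is harmless, as the coefficient \<open>real i\<close> vanishes.\<close>
  let ?f1 = "bmean_term L (deriv a) e i \<kappa> n \<psi>" and ?f2 = "bmean_term L (\<lambda>r. e * a r) (e - 1) i \<kappa> n \<psi>"
    and ?f3 = "bmean_term L (\<lambda>r. (- real i) * a r) (e - 1) (i - 1) \<kappa> n \<psi>"
    and ?f4 = "bmean_term L (\<lambda>r. (- 1/8) * a r) (e - 1) (Suc i) (\<lambda>s. \<kappa> s * (1 - s\<^sup>2)) (Suc n) \<psi>"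
    and ?f5 = "bmean_term L (\<lambda>r. (- 1) * a r) (e - 1) i (\<lambda>s. \<kappa> s * s) n (deriv \<psi>)"
  let ?f' = "\<lambda>r v. ?f1 r v + (?f2 r v + (?f3 r v + (?f4 r v + ?f5 r v)))"
  have "bmean_span L \<alpha> \<beta> R ?f'"
    by (intro bmean_span.bmean_span_add bmean_span.bmean_span_term smooth_deriv sc bmean_span_term(1,3-5) continuous_intros)
      (simp_all add: bmean_span_term(2) a' \<psi>')
  moreover have "((\<lambda>r. bmean_term L a e i \<kappa> n \<psi> r v) has_real_derivative ?f' r v) (at r)" for r v
  proof (cases "r < \<alpha>")
    case True
    then have "eventually (\<lambda>r. r < \<alpha>) (nhds r)"
      using eventually_nhds_in_open[of "{..<\<alpha>}" r] by simp
    then have "eventually (\<lambda>r. bmean_term L a e i \<kappa> n \<psi> r v = 0) (nhds r)"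
      by eventually_elim (simp add: bmean_term_def bmean_span_term(2))
    moreover have "?f' r v = 0" using True by (simp add: bmean_term_def bmean_span_term(2) a')
    ultimately show ?thesis
      using DERIV_cong_ev[of r r "\<lambda>r. bmean_term L a e i \<kappa> n \<psi> r v" "\<lambda>_. 0" 0 0] by simp
  next
    case False
    then have r: "r > 0" using assms(2) by simp
    have 1: "((\<lambda>r. r powr e) has_real_derivative e * r powr (e - 1)) (at r)"
      using has_real_derivative_powr[OF r] .
    have 2: "((\<lambda>r. L - ln r) has_real_derivative - (1 / r)) (at r)"
      using r by (auto intro!: derivative_eq_intros)
    note 3 = DERIV_chain2[OF DERIV_bmean_tau[OF bmean_span_term(5,3)] 2]
    have 4: "((\<lambda>r. (L - ln r) ^ i) has_real_derivative real i * (L - ln r) ^ (i - 1) * (- (1 / r))) (at r)"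
      using DERIV_power[OF 2, of i] by (simp add: mult_ac)
    have 5: "r powr e = r * r powr (e - 1)" using r by (simp add: powr_diff)
    show ?thesis
      unfolding bmean_term_def
      by (rule DERIV_cong[OF DERIV_mult[OF DERIV_mult[OF DERIV_mult[OF smooth_DERIV[OF bmean_span_term(1)] 1] 4] 3]])
        (use r in \<open>simp add: 5 field_simps\<close>)
  qed
  ultimately show ?case by blast
next
  case (bmean_span_add f g)
  then obtain f' g' where
    f': "bmean_span L \<alpha> \<beta> R f'" "\<And>r v. ((\<lambda>r. f r v) has_real_derivative f' r v) (at r)" and
    g': "bmean_span L \<alpha> \<beta> R g'" "\<And>r v. ((\<lambda>r. g r v) has_real_derivative g' r v) (at r)" by blast
  show ?case
    by (intro exI[of _ "\<lambda>r v. f' r v + g' r v"] conjI allI bmean_span.bmean_span_add DERIV_add f' g')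
qed

lemma bmean_span_pd_word:
  assumes "bmean_span L \<alpha> \<beta> R f" "0 < \<alpha>"
  shows "bmean_span L \<alpha> \<beta> R (pd_word w f)"
proof (induction w)
  case (Cons b w)
  from bmean_span_DERIV_r[OF Cons assms(2)] obtain f1 where
    f1: "bmean_span L \<alpha> \<beta> R f1" "\<And>r v. ((\<lambda>r. pd_word w f r v) has_real_derivative f1 r v) (at r)" by blast
  from bmean_span_DERIV_v[OF Cons] obtain f2 where
    f2: "bmean_span L \<alpha> \<beta> R f2" "\<And>r v. ((\<lambda>v. pd_word w f r v) has_real_derivative f2 r v) (at v)" by blast
  have "pd_r (pd_word w f) = f1" "pd_v (pd_word w f) = f2"
    unfolding pd_r_def pd_v_def using f1(2) f2(2) by (intro ext DERIV_imp_deriv; simp)+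
  with f1 f2 show ?case by simp
qed (use assms in simp)

lemma test2_J_span:
  assumes "bmean_span L \<alpha> \<beta> R f" "0 < \<alpha>" "\<alpha> < \<beta>"
  shows "test2 f"
  unfolding test2_def
proof (intro conjI allI)
  fix w r v
  note P = bmean_span_pd_word[OF assms(1,2), of w]
  show "continuous_on UNIV (\<lambda>(r, v). pd_word w f r v)"
    by (rule bmean_span_continuous[OF P assms(2)])
  from bmean_span_DERIV_r[OF P assms(2)] show "(\<lambda>t. pd_word w f t v) differentiable at r"
    unfolding real_differentiable_def by fast
  from bmean_span_DERIV_v[OF P] show "(\<lambda>t. pd_word w f r t) differentiable at v"
    unfolding real_differentiable_def by fast
next
  have "\<forall>r v. f r v \<noteq> 0 \<longrightarrow> \<alpha> \<le> r \<and> r \<le> \<beta> \<and> \<bar>v\<bar> \<le> R + (\<bar>L\<bar> + \<bar>ln \<alpha>\<bar> + \<bar>ln \<beta>\<bar>)"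
    using bmean_span_support[OF assms(1,2)] by simp
  with assms(2,3) show "\<exists>a b R. 0 < a \<and> a < b \<and> (\<forall>r v. f r v \<noteq> 0 \<longrightarrow> a \<le> r \<and> r \<le> b \<and> \<bar>v\<bar> \<le> R)"
    by blast
qed

section \<open>Pairing with backward solutions\<close>

text \<open>With \<open>r = exp t\<close>, the factor \<open>sqrt r\<close> turns the Klein-Gordon equation into \<open>w_rr = w_vv / r\<^sup>2\<close>.
  For \<open>L = ln \<rho>\<close> the solution \<open>wave\<close> has \<open>w = 0\<close> and \<open>w_r = - \<psi> / sqrt \<rho>\<close> at \<open>r = \<rho>\<close>.\<close>

definition wave :: "(real \<Rightarrow> real) \<Rightarrow> real \<Rightarrow> real \<Rightarrow> real \<Rightarrow> real" where
  "wave \<psi> L r v = sqrt r * kg \<psi> (L - ln r) v"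

definition wave' :: "(real \<Rightarrow> real) \<Rightarrow> real \<Rightarrow> real \<Rightarrow> real \<Rightarrow> real" where
  "wave' \<psi> L r v = (kg \<psi> (L - ln r) v / 2 - kg_t \<psi> (L - ln r) v) / sqrt r"

lemma DERIV_L_minus_ln:
  assumes "r > 0"
  shows "((\<lambda>r. L - ln r) has_real_derivative - (1 / r)) (at r)"
  using assms by (auto intro!: derivative_eq_intros)

lemma DERIV_wave:
  assumes "r > 0" "smooth \<psi>"
  shows "((\<lambda>r. wave \<psi> L r v) has_real_derivative wave' \<psi> L r v) (at r)"
proof -
  have sq: "(sqrt has_real_derivative inverse (sqrt r) / 2) (at r)"
    by (rule DERIV_real_sqrt[OF assms(1)])
  define q where "q = sqrt r"
  have q: "q > 0" "r = q * q" using assms(1) by (simp_all add: q_def)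
  show ?thesis
    unfolding wave_def wave'_def
    by (rule DERIV_cong[OF DERIV_mult[OF sq DERIV_chain2[OF DERIV_kg[OF assms(2)] DERIV_L_minus_ln[OF assms(1)]]]])
      (use q in \<open>simp add: field_simps flip: q_def\<close>)
qed

text \<open>The factor \<open>sqrt r\<close> is chosen so that the contributions of its derivatives
  cancel the first-order terms and the \<open>kg \<psi> / 4\<close> of the Klein-Gordon equation.
  Since v-derivatives pass to \<psi>, the right-hand side is w_vv / r^2.\<close>

lemma DERIV_wave':
  assumes "r > 0" "smooth \<psi>"
  shows "((\<lambda>r. wave' \<psi> L r v) has_real_derivative wave (deriv (deriv \<psi>)) L r v / r\<^sup>2) (at r)"
proof -
  have sq: "(sqrt has_real_derivative inverse (sqrt r) / 2) (at r)"
    by (rule DERIV_real_sqrt[OF assms(1)])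
  define q where "q = sqrt r"
  have q: "q > 0" "r = q * q" using assms(1) by (simp_all add: q_def)
  note ch = DERIV_chain2[OF DERIV_kg[OF assms(2)] DERIV_L_minus_ln[OF assms(1)]]
    DERIV_chain2[OF DERIV_kg_t[OF assms(2)] DERIV_L_minus_ln[OF assms(1)]]
  have sq0: "sqrt r \<noteq> 0" using assms(1) by simp
  show ?thesis
    unfolding wave_def wave'_def
    by (rule DERIV_cong[OF DERIV_divide[OF DERIV_diff[OF DERIV_cdivide[OF ch(1)] ch(2)] sq sq0]])
      (use q in \<open>simp add: field_simps power2_eq_square flip: q_def\<close>)
qed

lemma wave_continuous:
  assumes "smooth \<psi>"
  shows "continuous_on ({0<..} \<times> UNIV) (\<lambda>(r, v). wave \<psi> L r v)"
    and "continuous_on ({0<..} \<times> UNIV) (\<lambda>(r, v). wave' \<psi> L r v)"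
  unfolding wave_def wave'_def kg_def kg_t_def split_def
  by (intro continuous_intros bmean_continuous smooth_continuous_compose[OF assms] assms; auto)+

lemma wave_support:
  assumes "\<And>x. \<bar>x\<bar> > R \<Longrightarrow> \<psi> x = 0" "\<bar>v\<bar> > R + \<bar>L - ln r\<bar>"
  shows "wave \<psi> L r v = 0" "wave' \<psi> L r v = 0"
  using kg_support[OF assms] by (simp_all add: wave_def wave'_def)

lemma wave_support_interval:
  assumes "\<And>x. \<bar>x\<bar> > R \<Longrightarrow> \<psi> x = 0" "0 < a" "a \<le> r" "r \<le> b"
    and "\<bar>v\<bar> > R + (\<bar>L\<bar> + \<bar>ln a\<bar> + \<bar>ln b\<bar>)"
  shows "wave \<psi> L r v = 0" "wave' \<psi> L r v = 0"
proof -
  have "ln a \<le> ln r" "ln r \<le> ln b" using assms(2-4) by auto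
  then have "\<bar>v\<bar> > R + \<bar>L - ln r\<bar>" using assms(5) by linarith
  from wave_support[OF assms(1) this] show "wave \<psi> L r v = 0" "wave' \<psi> L r v = 0" by auto
qed

section \<open>Continuity and differentiability of pairings\<close>

lemma continuous_on_slice:
  assumes "continuous_on (S \<times> UNIV) (\<lambda>(r, v). f r v)" "r \<in> S"
  shows "continuous_on T (f r)"
proof -
  have "continuous_on T (\<lambda>v. (\<lambda>(r, v). f r v) (r, v))"
    by (rule continuous_on_compose2[OF assms(1)]) (use assms(2) in \<open>auto intro!: continuous_intros\<close>)
  then show ?thesis by simp
qed

lemma pair_compact_support:
  assumes "continuous_on UNIV (f r)" "continuous_on UNIV g" "\<And>v. \<bar>v\<bar> > N \<Longrightarrow> g v = 0"
  shows "integrable lborel (\<lambda>v. f r v * g v)" "pair f r g = integral {-N..N} (\<lambda>v. f r v * g v)"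
proof -
  have c: "continuous_on {-N..N} (\<lambda>v. f r v * g v)"
    by (intro continuous_intros continuous_on_subset[OF assms(1)] continuous_on_subset[OF assms(2)]) auto
  have z: "f r v * g v = 0" if "v \<notin> {-N..N}" for v
    using that assms(3)[of v] by (cases "\<bar>v\<bar> > N") auto
  show "integrable lborel (\<lambda>v. f r v * g v)" "pair f r g = integral {-N..N} (\<lambda>v. f r v * g v)"
    using lborel_integral_compact_support[OF c z] by (simp_all add: pair_def)
qed

text \<open>A support bound uniform in \<open>r\<close> turns the pairing into an integral over one
  fixed compact interval.\<close>

lemma pair_continuous:
  assumes "continuous_on (S \<times> UNIV) (\<lambda>(r, v). f r v)" "continuous_on (S \<times> UNIV) (\<lambda>(r, v). g r v)"
    and "\<And>r v. r \<in> S \<Longrightarrow> \<bar>v\<bar> > N \<Longrightarrow> g r v = 0"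
  shows "continuous_on S (\<lambda>r. pair f r (g r))"
proof (rule continuous_on_eq)
  show "continuous_on S (\<lambda>r. integral {-N..N} (\<lambda>v. f r v * g r v))"
  proof (rule integral_param_continuous)
    have "continuous_on (S \<times> {-N..N}) (\<lambda>x. (\<lambda>(r, v). f r v) x * (\<lambda>(r, v). g r v) x)"
      by (intro continuous_on_mult continuous_on_subset[OF assms(1)] continuous_on_subset[OF assms(2)]) auto
    then show "continuous_on (S \<times> {-N..N}) (\<lambda>(r, v). f r v * g r v)" by (simp add: split_def)
  qed
  show "integral {-N..N} (\<lambda>v. f r v * g r v) = pair f r (g r)" if "r \<in> S" for r
    using pair_compact_support(2)[of f r "g r" N, OF continuous_on_slice[OF assms(1) that]
      continuous_on_slice[OF assms(2) that] assms(3)[OF that]] by simp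
qed

lemma pair_linear:
  assumes "integrable lborel (\<lambda>v. f r v * g v)" "integrable lborel (\<lambda>v. f r v * h v)"
  shows "pair f r (\<lambda>v. c * g v + d * h v) = c * pair f r g + d * pair f r h"
proof -
  have "pair f r (\<lambda>v. c * g v + d * h v) = (LBINT v. c * (f r v * g v) + d * (f r v * h v))"
    by (simp add: pair_def algebra_simps)
  then show ?thesis using assms by (simp add: pair_def)
qed

text \<open>The pairing is only assumed differentiable in \<open>r\<close> against a fixed test function; the increment of the
  test function is handled by writing it as \<open>r - r0\<close> times a jointly continuous quotient.\<close>

lemma DERIV_pair_wave:
  assumes f: "continuous_on ({0<..} \<times> UNIV) (\<lambda>(r, v). f r v)" and \<psi>: "test1 \<psi>" and r0: "r0 > 0"
    and diff: "(\<lambda>t. pair f t (wave \<psi> L r0)) differentiable (at r0)"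
  shows "((\<lambda>t. pair f t (wave \<psi> L t)) has_real_derivative
    pair_r f r0 (wave \<psi> L r0) + pair f r0 (wave' \<psi> L r0)) (at r0)"
proof -
  from \<psi> obtain R where sm: "smooth \<psi>" and R: "\<And>x. \<bar>x\<bar> > R \<Longrightarrow> \<psi> x = 0"
    by (auto simp: test1_iff)
  define I where "I = {r0 / 2<..<2 * r0}"
  define N where "N = R + (\<bar>L\<bar> + \<bar>ln (r0 / 2)\<bar> + \<bar>ln (2 * r0)\<bar>)"
  have I: "open I" "r0 \<in> I" "I \<subseteq> {0<..}" using r0 by (auto simp: I_def)
  have seg: "r0 + \<theta> * (t - r0) \<in> I" if "t \<in> I" "\<theta> \<in> {0..1}" for t \<theta>
  proof -
    have "r0 + \<theta> * (t - r0) = (1 - \<theta>) *\<^sub>R r0 + \<theta> *\<^sub>R t" by (simp add: algebra_simps)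
    moreover have "convex I" by (simp add: I_def)
    ultimately show ?thesis using that I(2) by (simp add: convex_alt)
  qed
  \<comment> \<open>Hadamard's quotient: the mean of \<open>wave'\<close> along the segment from
    \<open>r0\<close> to \<open>t\<close>, which makes sense also at t = r0, where it equals
    \<open>wave'\<close>.\<close>
  define Q where "Q t v = integral {0..1} (\<lambda>\<theta>. wave' \<psi> L (r0 + \<theta> * (t - r0)) v)" for t v
  have w'c: "continuous_on T (\<lambda>x. wave' \<psi> L (p x) (q x))"
    if "continuous_on T p" "continuous_on T q" "\<And>x. x \<in> T \<Longrightarrow> p x > 0" for p q and T :: "'b::topological_space set"
  proof -
    have "continuous_on T (\<lambda>x. (\<lambda>(r, v). wave' \<psi> L r v) (p x, q x))"
      by (rule continuous_on_compose2[OF wave_continuous(2)[OF sm]])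
        (use that in \<open>auto intro!: continuous_intros\<close>)
    then show ?thesis by simp
  qed
  have Qc: "continuous_on (I \<times> UNIV) (\<lambda>x. Q (fst x) (snd x))"
    unfolding Q_def
  proof (rule integral_param_continuous)
    have "continuous_on ((I \<times> UNIV) \<times> {0..1}) (\<lambda>y. wave' \<psi> L (r0 + snd y * (fst (fst y) - r0)) (snd (fst y)))"
      by (rule w'c) (use seg I(3) in \<open>force intro!: continuous_intros\<close>)+
    then show "continuous_on ((I \<times> UNIV) \<times> {0..1}) (\<lambda>(x, \<theta>). wave' \<psi> L (r0 + \<theta> * (fst x - r0)) (snd x))"
      by (simp add: split_def)
  qed
  have QN: "Q t v = 0" if "t \<in> I" "\<bar>v\<bar> > N" for t v
  proof -
    have "wave' \<psi> L (r0 + \<theta> * (t - r0)) v = 0" if "\<theta> \<in> {0..1}" for \<theta>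
      by (rule wave_support_interval(2)[where a = "r0 / 2" and b = "2 * r0", OF R])
        (use seg[OF \<open>t \<in> I\<close> that] \<open>\<bar>v\<bar> > N\<close> r0 in \<open>simp_all add: I_def N_def\<close>)
    then have "Q t v = integral {0..1} (\<lambda>\<theta>::real. 0)" unfolding Q_def by (intro integral_cong) simp
    then show ?thesis by simp
  qed
  have Q_eq: "wave \<psi> L t v = wave \<psi> L r0 v + (t - r0) * Q t v" if "t \<in> I" for t v
  proof -
    have "((\<lambda>\<theta>. (t - r0) * wave' \<psi> L (r0 + \<theta> * (t - r0)) v) has_integral
        wave \<psi> L (r0 + 1 * (t - r0)) v - wave \<psi> L (r0 + 0 * (t - r0)) v) {0..1}"
    proof (rule fundamental_theorem_of_calculus)
      fix \<theta> :: real assume \<theta>: "\<theta> \<in> {0..1}"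
      have "((\<lambda>\<theta>. r0 + \<theta> * (t - r0)) has_real_derivative t - r0) (at \<theta>)"
        by (auto intro!: derivative_eq_intros)
      moreover have "r0 + \<theta> * (t - r0) > 0" using seg[OF that \<theta>] I(3) by auto
      ultimately have "((\<lambda>\<theta>. wave \<psi> L (r0 + \<theta> * (t - r0)) v) has_real_derivative
          wave' \<psi> L (r0 + \<theta> * (t - r0)) v * (t - r0)) (at \<theta>)"
        by (rule DERIV_chain2[OF DERIV_wave[OF _ sm], rotated])
      then show "((\<lambda>\<theta>. wave \<psi> L (r0 + \<theta> * (t - r0)) v) has_vector_derivative
          (t - r0) * wave' \<psi> L (r0 + \<theta> * (t - r0)) v) (at \<theta> within {0..1})"
        by (simp add: has_real_derivative_iff_has_vector_derivative[symmetric] mult.commute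
            has_field_derivative_at_within)
    qed simp
    then show ?thesis unfolding Q_def by (auto dest!: integral_unique)
  qed
  have fI: "continuous_on (I \<times> UNIV) (\<lambda>(r, v). f r v)"
    using f by (rule continuous_on_subset) (use I in auto)
  have Qc': "continuous_on (I \<times> UNIV) (\<lambda>(t, v). Q t v)" using Qc by (simp add: split_def)
  have fr: "continuous_on UNIV (f t)" if "t \<in> I" for t by (rule continuous_on_slice[OF fI that])
  have eq: "pair f t (wave \<psi> L t) = pair f t (wave \<psi> L r0) + (t - r0) * pair f t (Q t)" if "t \<in> I" for t
  proof -
    have "pair f t (wave \<psi> L t) = pair f t (\<lambda>v. 1 * wave \<psi> L r0 v + (t - r0) * Q t v)"
      using Q_eq[OF that] by (simp add: pair_def)
    also have "\<dots> = 1 * pair f t (wave \<psi> L r0) + (t - r0) * pair f t (Q t)"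
    proof (rule pair_linear)
      show "integrable lborel (\<lambda>v. f t v * wave \<psi> L r0 v)"
      proof (rule pair_compact_support(1)[of f t, OF fr[OF that]])
        show "continuous_on UNIV (wave \<psi> L r0)"
          by (rule continuous_on_slice[OF wave_continuous(1)[OF sm]]) (use r0 in simp)
        show "wave \<psi> L r0 v = 0" if "\<bar>v\<bar> > R + \<bar>L - ln r0\<bar>" for v
          by (rule wave_support(1)[OF R that])
      qed
      show "integrable lborel (\<lambda>v. f t v * Q t v)"
        by (rule pair_compact_support(1)[of f t "Q t" N, OF fr[OF that] continuous_on_slice[OF Qc' that] QN[OF that]])
    qed
    finally show ?thesis by simp
  qed
  \<comment> \<open>By Caratheodory's criterion, (t - r0) g(t) has derivative g(r0) at r0 as soon as
    g is continuous there, so no derivative of \<open>f\<close> is involved.\<close>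
  have "isCont (\<lambda>t. pair f t (Q t)) r0"
    using pair_continuous[OF fI Qc' QN] I(1,2) by (simp add: continuous_on_eq_continuous_at)
  then have "((\<lambda>t. (t - r0) * pair f t (Q t)) has_real_derivative pair f r0 (Q r0)) (at r0)"
    unfolding CARAT_DERIV by (intro exI[of _ "\<lambda>t. pair f t (Q t)"]) (simp add: mult.commute)
  moreover have "Q r0 = wave' \<psi> L r0" by (simp add: Q_def fun_eq_iff)
  moreover have "((\<lambda>t. pair f t (wave \<psi> L r0)) has_real_derivative pair_r f r0 (wave \<psi> L r0)) (at r0)"
    using diff unfolding pair_r_def by (simp add: DERIV_deriv_iff_real_differentiable)
  ultimately have "((\<lambda>t. pair f t (wave \<psi> L r0) + (t - r0) * pair f t (Q t)) has_real_derivative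
      pair_r f r0 (wave \<psi> L r0) + pair f r0 (wave' \<psi> L r0)) (at r0)"
    using DERIV_add by metis
  moreover have "eventually (\<lambda>t. pair f t (wave \<psi> L t) = pair f t (wave \<psi> L r0) + (t - r0) * pair f t (Q t)) (nhds r0)"
    using eventually_nhds_in_open[OF I(1,2)] by eventually_elim (rule eq)
  ultimately show ?thesis by (simp add: DERIV_cong_ev)
qed

text \<open>The undifferentiated cutoff multiplies the same term in both second derivatives, so
  applying the wave operator to the product leaves only terms with derivatives of
  \<open>a\<close>.\<close>

lemma test_times_wave:
  fixes L :: real
  assumes a: "smooth a" "\<And>r. r \<notin> {\<alpha>..\<beta>} \<Longrightarrow> a r = 0" and \<alpha>: "0 < \<alpha>" "\<alpha> < \<beta>" and \<psi>: "test1 \<psi>"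
  defines "\<phi> \<equiv> \<lambda>r v. a r * wave \<psi> L r v"
  shows "test2 \<phi>"
    and "pd_v (pd_v \<phi>) = (\<lambda>r v. a r * wave (deriv (deriv \<psi>)) L r v)"
    and "pd_r (pd_r \<phi>) = (\<lambda>r v. deriv (deriv a) r * wave \<psi> L r v + 2 * deriv a r * wave' \<psi> L r v
        + a r * (wave (deriv (deriv \<psi>)) L r v / r\<^sup>2))"
proof -
  from \<psi> obtain R where sm: "smooth \<psi>" and R: "\<And>x. \<bar>x\<bar> > R \<Longrightarrow> \<psi> x = 0"
    by (auto simp: test1_iff)
  have a'0: "deriv a r = 0" if "r \<notin> {\<alpha>..\<beta>}" for r
    using deriv_support[of "{\<alpha>..\<beta>}", OF _ a(2) that] by simp
  have "deriv (deriv a) r = 0" if "r \<notin> {\<alpha>..\<beta>}" for r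
    using deriv_support[of "{\<alpha>..\<beta>}", OF _ a'0 that] by simp
  note a0 = a(2) a'0 this
  \<comment> \<open>The coefficient 1/2 and the power 1 come from the factor \<tau> / 2 in
    \<open>kg\<close>, the exponent 1/2 from \<open>sqrt r\<close>. For r < \<alpha> both sides
    vanish through the cutoff, whatever the default values at r \<le> 0.\<close>
  have "\<phi> = bmean_term L (\<lambda>r. 1/2 * a r) (1/2) 1 (\<lambda>_. 1) 0 \<psi>"
  proof (intro ext)
    fix r v
    show "\<phi> r v = bmean_term L (\<lambda>r. 1/2 * a r) (1/2) 1 (\<lambda>_. 1) 0 \<psi> r v"
    proof (cases "r < \<alpha>")
      case True
      then show ?thesis by (simp add: \<phi>_def bmean_term_def a0)
    next
      case False
      then show ?thesis using \<alpha>(1) by (simp add: \<phi>_def bmean_term_def wave_def kg_def powr_half_sqrt)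
    qed
  qed
  moreover have "bmean_span L \<alpha> \<beta> R (bmean_term L (\<lambda>r. 1/2 * a r) (1/2) 1 (\<lambda>_. 1) 0 \<psi>)"
    by (intro bmean_span_term smooth_mult smooth_const a(1) sm R continuous_intros) (simp_all add: a0)
  ultimately show "test2 \<phi>" using test2_J_span[OF _ \<alpha>] by simp
  have v: "((\<lambda>v. a r * wave \<psi> L r v) has_real_derivative a r * wave (deriv \<psi>) L r v) (at v)"
    if "smooth \<psi>" for \<psi> r v
    unfolding wave_def by (intro DERIV_cmult DERIV_kg_v that)
  have "pd_v \<phi> = (\<lambda>r v. a r * wave (deriv \<psi>) L r v)"
    unfolding pd_v_def \<phi>_def by (intro ext DERIV_imp_deriv v sm)
  then show "pd_v (pd_v \<phi>) = (\<lambda>r v. a r * wave (deriv (deriv \<psi>)) L r v)"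
    by (simp add: pd_v_def[abs_def]) (intro ext DERIV_imp_deriv v smooth_deriv sm)
  \<comment> \<open>Disposes of the region left of the support, which contains the r \<le> 0 where
    the wave is not differentiated.\<close>
  have cut: "(g has_real_derivative g') (at r)"
    if "r < \<alpha>" "\<And>t. t < \<alpha> \<Longrightarrow> g t = 0" "g' = 0" for g :: "real \<Rightarrow> real" and g' r
  proof -
    have "eventually (\<lambda>t. t < \<alpha>) (nhds r)"
      using eventually_nhds_in_open[of "{..<\<alpha>}" r] that(1) by simp
    then have "eventually (\<lambda>t. g t = 0) (nhds r)" by eventually_elim (rule that(2))
    then show ?thesis using DERIV_cong_ev[of r r g "\<lambda>_. 0" 0 0] that(3) by simp
  qed
  have r1: "((\<lambda>r. a r * wave \<psi> L r v) has_real_derivative deriv a r * wave \<psi> L r v + a r * wave' \<psi> L r v) (at r)" for r v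
  proof (cases "r < \<alpha>")
    case False
    then have "r > 0" using \<alpha>(1) by simp
    from DERIV_mult[OF smooth_DERIV[OF a(1)] DERIV_wave[OF this sm]] show ?thesis
      by (rule DERIV_cong) simp
  qed (rule cut, auto simp: a0)
  have r2: "((\<lambda>r. deriv a r * wave \<psi> L r v + a r * wave' \<psi> L r v) has_real_derivative
      deriv (deriv a) r * wave \<psi> L r v + 2 * deriv a r * wave' \<psi> L r v
        + a r * (wave (deriv (deriv \<psi>)) L r v / r\<^sup>2)) (at r)" for r v
  proof (cases "r < \<alpha>")
    case False
    then have "r > 0" using \<alpha>(1) by simp
    from DERIV_add[OF DERIV_mult[OF smooth_DERIV[OF smooth_deriv[OF a(1)]] DERIV_wave[OF this sm]]
        DERIV_mult[OF smooth_DERIV[OF a(1)] DERIV_wave'[OF this sm]]]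
    show ?thesis by (rule DERIV_cong) simp
  qed (rule cut, auto simp: a0)
  have "pd_r \<phi> = (\<lambda>r v. deriv a r * wave \<psi> L r v + a r * wave' \<psi> L r v)"
    unfolding pd_r_def \<phi>_def by (intro ext DERIV_imp_deriv r1)
  note e = this
  show "pd_r (pd_r \<phi>) = (\<lambda>r v. deriv (deriv a) r * wave \<psi> L r v + 2 * deriv a r * wave' \<psi> L r v
        + a r * (wave (deriv (deriv \<psi>)) L r v / r\<^sup>2))"
    unfolding e by (intro ext, unfold pd_r_def, rule DERIV_imp_deriv, rule r2)
qed

section \<open>Conservation of the Wronskian\<close>

lemma pair_wave_integrable:
  assumes f: "continuous_on ({0<..} \<times> UNIV) (\<lambda>(r, v). f r v)" and \<psi>: "test1 \<psi>" and r: "r > 0"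
  shows "integrable lborel (\<lambda>v. f r v * wave \<psi> L r v)" "integrable lborel (\<lambda>v. f r v * wave' \<psi> L r v)"
proof -
  from \<psi> obtain R where sm: "smooth \<psi>" and R: "\<And>x. \<bar>x\<bar> > R \<Longrightarrow> \<psi> x = 0"
    by (auto simp: test1_iff)
  have r': "r \<in> {0<..}" using r by simp
  note fr = continuous_on_slice[OF f r']
  show "integrable lborel (\<lambda>v. f r v * wave \<psi> L r v)"
    using pair_compact_support(1)[of f r "wave \<psi> L r", OF fr continuous_on_slice[OF wave_continuous(1)[OF sm] r']
      wave_support(1)[OF R]] by simp
  show "integrable lborel (\<lambda>v. f r v * wave' \<psi> L r v)"
    using pair_compact_support(1)[of f r "wave' \<psi> L r", OF fr continuous_on_slice[OF wave_continuous(2)[OF sm] r']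
      wave_support(2)[OF R]] by simp
qed

lemma pair_wave_continuous:
  assumes f: "continuous_on ({0<..} \<times> UNIV) (\<lambda>(r, v). f r v)" and \<psi>: "test1 \<psi>"
  shows "continuous_on {0<..} (\<lambda>r. pair f r (wave \<psi> L r))"
    and "continuous_on {0<..} (\<lambda>r. pair f r (wave' \<psi> L r))"
proof -
  from \<psi> obtain R where sm: "smooth \<psi>" and R: "\<And>x. \<bar>x\<bar> > R \<Longrightarrow> \<psi> x = 0"
    by (auto simp: test1_iff)
  have "isCont (\<lambda>r. pair f r (wave \<psi> L r)) x \<and> isCont (\<lambda>r. pair f r (wave' \<psi> L r)) x"
    if "x > 0" for x
  proof -
    \<comment> \<open>The cone widens without bound as r tends to 0 or to infinity, so a uniform
      support bound is available only locally.\<close>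
    define I where "I = {x / 2<..<2 * x}"
    have I: "open I" "x \<in> I" "I \<times> UNIV \<subseteq> {0<..} \<times> (UNIV :: real set)" using that by (auto simp: I_def)
    have z: "wave \<psi> L r v = 0" "wave' \<psi> L r v = 0"
      if "r \<in> I" "\<bar>v\<bar> > R + (\<bar>L\<bar> + \<bar>ln (x / 2)\<bar> + \<bar>ln (2 * x)\<bar>)" for r v
      by (rule wave_support_interval[where a = "x / 2" and b = "2 * x", OF R];
        use that \<open>x > 0\<close> in \<open>simp add: I_def\<close>)+
    have "continuous_on I (\<lambda>r. pair f r (wave \<psi> L r))"
      using pair_continuous[OF continuous_on_subset[OF f I(3)]
        continuous_on_subset[OF wave_continuous(1)[OF sm] I(3)] z(1)] .
    moreover have "continuous_on I (\<lambda>r. pair f r (wave' \<psi> L r))"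
      using pair_continuous[OF continuous_on_subset[OF f I(3)]
        continuous_on_subset[OF wave_continuous(2)[OF sm] I(3)] z(2)] .
    ultimately show ?thesis using I(1,2) by (simp add: continuous_on_eq_continuous_at)
  qed
  then show "continuous_on {0<..} (\<lambda>r. pair f r (wave \<psi> L r))"
    and "continuous_on {0<..} (\<lambda>r. pair f r (wave' \<psi> L r))"
    by (simp_all add: continuous_on_eq_continuous_at)
qed

text \<open>With A and B the two pairings and G a primitive of B, integrating \<open>a' B\<close> by
  parts turns the weak equation into a statement about \<open>a''\<close> times A - 2 G alone. This
  needs only continuity of A and B.\<close>

lemma wave_pairing_affine:
  assumes f: "continuous_on ({0<..} \<times> UNIV) (\<lambda>(r, v). f r v)"
    and weak: "\<And>\<phi> \<alpha>. test2 \<phi> \<Longrightarrow> 1 < \<alpha> \<Longrightarrow> (\<And>r v. r < \<alpha> \<Longrightarrow> \<phi> r v = 0) \<Longrightarrow>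
      (LBINT r. LBINT v. f r v * (pd_r (pd_r \<phi>) r v - pd_v (pd_v \<phi>) r v / r\<^sup>2)) = 0"
    and \<psi>: "test1 \<psi>"
  obtains c m where "\<And>r. r \<ge> 1 \<Longrightarrow>
    pair f r (wave \<psi> L r) = c + m * r + 2 * integral {1..r} (\<lambda>s. pair f s (wave' \<psi> L s))"
proof -
  define A where "A r = pair f r (wave \<psi> L r)" for r
  define B where "B r = pair f r (wave' \<psi> L r)" for r
  define G where "G r = integral {1..r} B" for r
  have AB: "continuous_on {0<..} A" "continuous_on {0<..} B"
    unfolding A_def B_def using pair_wave_continuous[OF f \<psi>] by auto
  have Bc: "continuous_on {1..b} B" for b by (rule continuous_on_subset[OF AB(2)]) auto
  have G': "(G has_real_derivative B t) (at t within {1..b})" if "t \<in> {1..b}" for t b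
    unfolding G_def by (rule integral_has_real_derivative[OF Bc that])
  have Gc: "continuous_on {1..b} G" for b
    using DERIV_continuous_on[OF G'] .
  have Gc1: "continuous_on {1..} G"
    unfolding continuous_on_eq_continuous_within
  proof
    fix x :: real assume x: "x \<in> {1..}"
    have "continuous (at x within {1..x + 1}) G"
      using Gc[of "x + 1"] x by (simp add: continuous_on_eq_continuous_within)
    moreover have "at x within {1..x + 1} = at x within {1..}"
      by (rule at_within_nhd[of _ "{x - 1<..<x + 1}"]) auto
    ultimately show "continuous (at x within {1..}) G" by simp
  qed
  \<comment> \<open>Frozen to the left of 1 to be continuous on the whole line; the cutoffs live in
    r > 1 and do not see the extension.\<close>
  define D where "D r = A (max 1 r) - 2 * G (max 1 r)" for r
  have D: "continuous_on UNIV D"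
    unfolding D_def
    by (intro continuous_intros continuous_on_compose2[OF AB(1)] continuous_on_compose2[OF Gc1]) auto
  have "(LBINT r. deriv (deriv a) r * D r) = 0"
    if a: "smooth a" "1 < \<alpha>" "\<And>r. r \<notin> {\<alpha>..\<beta>} \<Longrightarrow> a r = 0" for a \<alpha> \<beta>
  proof -
    \<comment> \<open>Exceeds both bounds, so that \<alpha> < b holds even for an empty support
      interval and \<open>deriv a\<close> vanishes at b, which kills the boundary term.\<close>
    define b where "b = max \<alpha> \<beta> + 1"
    let ?a1 = "deriv a" and ?a2 = "deriv (deriv a)"
    have a'0: "?a1 r = 0" if "r \<notin> {\<alpha>..\<beta>}" for r
      using deriv_support[of "{\<alpha>..\<beta>}", OF _ a(3) that] by simp
    have a''0: "?a2 r = 0" if "r \<notin> {\<alpha>..\<beta>}" for r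
      using deriv_support[of "{\<alpha>..\<beta>}", OF _ a'0 that] by simp
    have sub: "{\<alpha>..\<beta>} \<subseteq> {1..b}" using a(2) by (auto simp: b_def)
    have c1: "continuous_on S ?a1" and c2: "continuous_on S ?a2" for S
      by (intro smooth_imp_continuous_on smooth_deriv a(1))+
    have Ac: "continuous_on {1..b} A" by (rule continuous_on_subset[OF AB(1)]) auto
    let ?\<phi> = "\<lambda>r v. a r * wave \<psi> L r v"
    have \<alpha>: "0 < \<alpha>" "\<alpha> < b" using a(2) by (auto simp: b_def)
    have ab: "a r = 0" if "r \<notin> {\<alpha>..b}" for r using that by (intro a(3)) (auto simp: b_def)
    note tw = test_times_wave[where L = L, OF a(1) _ \<alpha> \<psi>]
    have tw1: "test2 ?\<phi>" by (rule tw(1)) (rule ab)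
    have tw2: "pd_v (pd_v ?\<phi>) = (\<lambda>r v. a r * wave (deriv (deriv \<psi>)) L r v)"
      by (rule tw(2)) (rule ab)
    have tw3: "pd_r (pd_r ?\<phi>) = (\<lambda>r v. ?a2 r * wave \<psi> L r v + 2 * ?a1 r * wave' \<psi> L r v
        + a r * (wave (deriv (deriv \<psi>)) L r v / r\<^sup>2))"
      by (rule tw(3)) (rule ab)
    have "(LBINT r. LBINT v. f r v * (pd_r (pd_r ?\<phi>) r v - pd_v (pd_v ?\<phi>) r v / r\<^sup>2)) = 0"
      by (rule weak[OF tw1 a(2)]) (use a(3) in auto)
    moreover have "(LBINT v. f r v * (pd_r (pd_r ?\<phi>) r v - pd_v (pd_v ?\<phi>) r v / r\<^sup>2))
        = ?a2 r * A r + 2 * ?a1 r * B r" for r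
    proof (cases "r \<in> {\<alpha>..\<beta>}")
      case False
      then show ?thesis unfolding tw2 tw3 by (simp add: a(3) a'0 a''0)
    next
      case True
      then have "r > 0" using \<alpha> by simp
      have "(LBINT v. f r v * (pd_r (pd_r ?\<phi>) r v - pd_v (pd_v ?\<phi>) r v / r\<^sup>2))
          = pair f r (\<lambda>v. ?a2 r * wave \<psi> L r v + (2 * ?a1 r) * wave' \<psi> L r v)"
        unfolding tw2 tw3 by (simp add: pair_def)
      then show ?thesis
        by (simp only: pair_linear[where f = f and r = r, OF pair_wave_integrable[OF f \<psi> \<open>r > 0\<close>]] A_def B_def)
    qed
    ultimately have "(LBINT r. ?a2 r * A r + 2 * ?a1 r * B r) = 0" by simp
    moreover have "(LBINT r. ?a2 r * A r + 2 * ?a1 r * B r) = integral {1..b} (\<lambda>r. ?a2 r * A r + 2 * ?a1 r * B r)"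
    proof (rule lborel_integral_compact_support(2))
      show "?a2 r * A r + 2 * ?a1 r * B r = 0" if "r \<notin> {1..b}" for r
      proof -
        have "r \<notin> {\<alpha>..\<beta>}" using that sub by blast
        then show ?thesis by (simp add: a'0 a''0)
      qed
    qed (intro continuous_intros c1 c2 Ac Bc)
    ultimately have 1: "integral {1..b} (\<lambda>r. ?a2 r * A r + 2 * ?a1 r * B r) = 0" by simp
    have "((\<lambda>r. ?a2 r * G r + ?a1 r * B r) has_integral ?a1 b * G b - ?a1 1 * G 1) {1..b}"
    proof (rule fundamental_theorem_of_calculus)
      fix t assume t: "t \<in> {1..b}"
      have "(?a1 has_real_derivative ?a2 t) (at t within {1..b})"
        by (rule has_field_derivative_at_within[OF smooth_DERIV[OF smooth_deriv[OF a(1)]]])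
      from DERIV_mult[OF this G'[OF t]]
      show "((\<lambda>r. ?a1 r * G r) has_vector_derivative ?a2 t * G t + ?a1 t * B t) (at t within {1..b})"
        by (simp add: has_real_derivative_iff_has_vector_derivative[symmetric] mult.commute)
    qed (use a(2) in \<open>simp add: b_def\<close>)
    moreover have "?a1 b = 0" by (rule a'0) (auto simp: b_def)
    moreover have "?a1 1 = 0" by (rule a'0) (use a(2) in simp)
    ultimately have 2: "((\<lambda>r. ?a2 r * G r + ?a1 r * B r) has_integral 0) {1..b}" by simp
    have "(LBINT r. ?a2 r * D r) = integral {1..b} (\<lambda>r. ?a2 r * D r)"
    proof (rule lborel_integral_compact_support(2))
      show "continuous_on {1..b} (\<lambda>r. ?a2 r * D r)"
        by (intro continuous_intros c2 continuous_on_subset[OF D]) auto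
      show "?a2 r * D r = 0" if "r \<notin> {1..b}" for r
      proof -
        have "r \<notin> {\<alpha>..\<beta>}" using that sub by blast
        then show ?thesis by (simp add: a''0)
      qed
    qed
    also have "\<dots> = integral {1..b} (\<lambda>r. (?a2 r * A r + 2 * ?a1 r * B r) - 2 * (?a2 r * G r + ?a1 r * B r))"
      by (intro integral_cong) (simp add: D_def algebra_simps)
    also have "\<dots> = integral {1..b} (\<lambda>r. ?a2 r * A r + 2 * ?a1 r * B r)
        - integral {1..b} (\<lambda>r. 2 * (?a2 r * G r + ?a1 r * B r))"
      by (intro integral_diff integrable_continuous_real continuous_intros c1 c2 Ac Bc Gc)
    also have "\<dots> = 0" by (simp only: integral_mult_right integral_unique[OF 2] 1)
    finally show ?thesis .
  qed
  note weak_D = this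
  show ?thesis
  proof (rule weak_second_derivative_0_imp_affine[OF D])
    show "(LBINT r. deriv (deriv a) r * D r) = 0"
      if "smooth a" "1 < \<alpha>" "\<And>r. r \<notin> {\<alpha>..\<beta>} \<Longrightarrow> a r = 0" for a \<alpha> \<beta>
      by (rule weak_D[OF that])
    fix c m assume Dcm: "\<And>r. r \<ge> 1 \<Longrightarrow> D r = c + m * r"
    have "A r = c + m * r + 2 * G r" if "r \<ge> 1" for r
      using Dcm[OF that] that by (simp add: D_def max_absorb2)
    then show ?thesis by (intro that[of c m]) (simp add: A_def G_def B_def[abs_def])
  qed
qed

text \<open>Stated for a general weak solution so that it covers both kernels: the source term of
  the flux equation vanishes for r > 1. The slope \<open>m\<close> of the affine law is the
  Wronskian, evaluated at r = \<rho> and at r = 1.\<close>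

lemma weak_solution_representation:
  assumes f: "continuous_on ({0<..} \<times> UNIV) (\<lambda>(r, v). f r v)"
    and weak: "\<And>\<phi> \<alpha>. test2 \<phi> \<Longrightarrow> 1 < \<alpha> \<Longrightarrow> (\<And>r v. r < \<alpha> \<Longrightarrow> \<phi> r v = 0) \<Longrightarrow>
      (LBINT r. LBINT v. f r v * (pd_r (pd_r \<phi>) r v - pd_v (pd_v \<phi>) r v / r\<^sup>2)) = 0"
    and diff: "\<And>\<psi> r. test1 \<psi> \<Longrightarrow> r > 0 \<Longrightarrow> (\<lambda>t. pair f t \<psi>) differentiable (at r)"
    and \<rho>: "\<rho> \<ge> 1" and \<psi>: "test1 \<psi>"
  shows "pair f \<rho> \<psi> = pair_r f 1 (conv_sharp \<rho> \<psi>) + pair f 1 (conv_flat \<rho> \<psi>)"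
proof -
  define L where "L = ln \<rho>"
  from \<psi> have sm: "smooth \<psi>" by (simp add: test1_iff)
  obtain c m where cm: "\<And>r. r \<ge> 1 \<Longrightarrow>
    pair f r (wave \<psi> L r) = c + m * r + 2 * integral {1..r} (\<lambda>s. pair f s (wave' \<psi> L s))"
    by (rule wave_pairing_affine[OF f weak \<psi>]) blast+
  have pair_cmult: "pair f t (\<lambda>v. k * g v) = k * pair f t g" for t k g
    by (simp add: pair_def mult.left_commute)
  have d_cmult: "(\<lambda>t. pair f t (\<lambda>v. k * g v)) differentiable at r"
    "pair_r f r (\<lambda>v. k * g v) = k * pair_r f r g" if "test1 g" "r > 0" for k g r
    using diff[OF that] DERIV_cmult[of "\<lambda>t. pair f t g" _ r UNIV k]
    by (auto simp: pair_cmult pair_r_def real_differentiable_def DERIV_imp_deriv intro!: DERIV_cmult)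
  have m: "m = pair_r f r (wave \<psi> L r) - pair f r (wave' \<psi> L r)" if r: "r \<ge> 1" for r
  proof -
    \<comment> \<open>A one-sided interval, because at r = 1 the affine law is known only to the
      right. The two-sided derivative supplied by \<open>diff\<close> restricts to it, and
      uniqueness of the one-sided derivative gives \<open>m\<close>.\<close>
    let ?S = "{r..r + 1}"
    let ?B = "\<lambda>s. pair f s (wave' \<psi> L s)"
    have "continuous_on {1..r + 1} ?B"
      by (rule continuous_on_subset[OF pair_wave_continuous(2)[OF f \<psi>]]) auto
    then have "((\<lambda>x. integral {1..x} ?B) has_real_derivative ?B r) (at r within {1..r + 1})"
      by (rule integral_has_real_derivative) (use r in simp)
    then have "((\<lambda>x. integral {1..x} ?B) has_real_derivative ?B r) (at r within ?S)"
      by (rule DERIV_subset) (use r in auto)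
    then have "((\<lambda>x. c + m * x + 2 * integral {1..x} ?B) has_real_derivative m + 2 * ?B r) (at r within ?S)"
      by (auto intro!: derivative_eq_intros)
    then have 1: "((\<lambda>x. pair f x (wave \<psi> L x)) has_real_derivative m + 2 * ?B r) (at r within ?S)"
      by (rule has_field_derivative_transform_within[where d = 1]) (use r cm in auto)
    have "wave \<psi> L r = (\<lambda>v. sqrt r * kg \<psi> (L - ln r) v)" by (simp add: wave_def fun_eq_iff)
    then have "(\<lambda>t. pair f t (wave \<psi> L r)) differentiable (at r)"
      using d_cmult(1)[OF test1_kg[OF \<psi>]] r by simp
    then have "((\<lambda>x. pair f x (wave \<psi> L x)) has_real_derivative pair_r f r (wave \<psi> L r) + ?B r) (at r)"
      by (intro DERIV_pair_wave f \<psi>) (use r in auto)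
    then have 2: "((\<lambda>x. pair f x (wave \<psi> L x)) has_real_derivative pair_r f r (wave \<psi> L r) + ?B r) (at r within ?S)"
      by (rule has_field_derivative_at_within)
    have "at r within ?S \<noteq> bot" by (simp add: at_within_Icc_at_right)
    from has_field_derivative_unique[OF 1 2 this] show ?thesis by simp
  qed
  have "m = pair f \<rho> \<psi> / sqrt \<rho>"
  proof -
    \<comment> \<open>At r = \<rho> the propagator time is 0, so only the velocity datum survives
      and the unknown r-derivative of the pairing drops out.\<close>
    have "wave \<psi> L \<rho> = (\<lambda>v. 0)" "wave' \<psi> L \<rho> = (\<lambda>v. (- 1 / sqrt \<rho>) * \<psi> v)"
      by (simp_all add: wave_def wave'_def kg_def kg_t_def L_def fun_eq_iff)
    then show ?thesis using m[OF \<rho>] by (simp add: pair_cmult pair_r_def) (simp add: pair_def)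
  qed
  moreover have "m = pair_r f 1 (kg \<psi> L) - pair f 1 (wave' \<psi> L 1)"
  proof -
    have "wave \<psi> L 1 = kg \<psi> L" by (simp add: wave_def fun_eq_iff)
    then show ?thesis using m[of 1] by simp
  qed
  ultimately have "pair f \<rho> \<psi> = sqrt \<rho> * pair_r f 1 (kg \<psi> L) + (- sqrt \<rho>) * pair f 1 (wave' \<psi> L 1)"
    using \<rho> by (simp add: field_simps)
  also have "sqrt \<rho> * pair_r f 1 (kg \<psi> L) = pair_r f 1 (\<lambda>w. sqrt \<rho> * kg \<psi> L w)"
    by (rule d_cmult(2)[OF test1_kg[OF \<psi>], symmetric]) simp
  also have "(\<lambda>w. sqrt \<rho> * kg \<psi> L w) = conv_sharp \<rho> \<psi>"
    using conv_sharp_eq[OF \<rho> sm] by (simp add: L_def fun_eq_iff)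
  also have "(- sqrt \<rho>) * pair f 1 (wave' \<psi> L 1) = pair f 1 (\<lambda>w. (- sqrt \<rho>) * wave' \<psi> L 1 w)"
    by (rule pair_cmult[symmetric])
  also have "(\<lambda>w. (- sqrt \<rho>) * wave' \<psi> L 1 w) = conv_flat \<rho> \<psi>"
    using conv_flat_eq[OF \<rho> sm] by (simp add: L_def fun_eq_iff wave'_def algebra_simps)
  finally show ?thesis .
qed

theorem theorem2p6:
  fixes p :: "real \<Rightarrow> real"
    and chi :: "real \<Rightarrow> real \<Rightarrow> real"
    and \<sigma> :: "real \<Rightarrow> real \<Rightarrow> real \<Rightarrow> real"
    and h :: "real \<Rightarrow> real \<Rightarrow> real"
  assumes "P1 p" and "P2 p" and "P3 p"
    and "entropy_kernel p chi"
    and "entropy_flux_kernel p chi \<sigma> h"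
  shows "\<forall>\<rho>\<ge>1. \<forall>\<psi>. test1 \<psi> \<longrightarrow>
           pair chi \<rho> \<psi> = pair_r chi 1 (conv_sharp \<rho> \<psi>) + pair chi 1 (conv_flat \<rho> \<psi>)
         \<and> pair h \<rho> \<psi> = pair_r h 1 (conv_sharp \<rho> \<psi>) + pair h 1 (conv_flat \<rho> \<psi>)"
proof -
  have p': "deriv p r = 1" "deriv (deriv p) r = 0" if "r > 1" for r
  proof -
    have near: "eventually (\<lambda>t. t > 1) (nhds r)" if "r > 1" for r :: real
      using eventually_nhds_in_open[of "{1<..}" r] that by simp
    have d: "deriv p r = 1" if "r > 1" for r
    proof -
      have "eventually (\<lambda>t. p t = t) (nhds r)"
        using near[OF that] by eventually_elim (use assms(2) in \<open>simp add: P2_def\<close>)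
      then show ?thesis using deriv_cong_ev[of p "\<lambda>t. t" r r] by simp
    qed
    from d that show "deriv p r = 1" .
    have "eventually (\<lambda>t. deriv p t = 1) (nhds r)"
      using near[OF that] by eventually_elim (rule d)
    then show "deriv (deriv p) r = 0" using deriv_cong_ev[of "deriv p" "\<lambda>t. 1" r r] by simp
  qed
  \<comment> \<open>Whatever the coefficients are for r \<le> 1, they multiply v-derivatives of
    \<phi>, which vanish there because \<phi> is zero on the whole v-line; hence the explicit
    coefficients may be substituted at every r.\<close>
  have pd0: "pd_v \<phi> r v = 0" "pd_v (pd_v \<phi>) r v = 0" if "r \<le> 1" "1 < \<alpha>" "\<forall>r v. r < \<alpha> \<longrightarrow> \<phi> r v = 0"
    for \<phi> \<alpha> r v
  proof -
    have "\<phi> r = (\<lambda>v. 0)" using that by (auto simp: fun_eq_iff)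
    then have "pd_v \<phi> r = (\<lambda>v. 0)" by (auto simp: pd_v_def fun_eq_iff)
    then show "pd_v \<phi> r v = 0" "pd_v (pd_v \<phi>) r v = 0" by (simp_all add: pd_v_def[of "pd_v \<phi>"])
  qed
  have k: "(kprime p r)\<^sup>2 * pd_v (pd_v \<phi>) r v = pd_v (pd_v \<phi>) r v / r\<^sup>2"
    if "1 < \<alpha>" "\<forall>r v. r < \<alpha> \<longrightarrow> \<phi> r v = 0" for \<phi> \<alpha> r v
  proof (cases "r > 1")
    case True
    then show ?thesis by (simp add: kprime_def p' power_divide)
  next
    case False
    then show ?thesis using pd0(2)[where r = r and \<alpha> = \<alpha> and \<phi> = \<phi>, OF _ that] by simp
  qed
  have q: "deriv (deriv p) r / r * c * pd_v \<phi> r v = 0"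
    if "1 < \<alpha>" "\<forall>r v. r < \<alpha> \<longrightarrow> \<phi> r v = 0" for \<phi> \<alpha> r v c
  proof (cases "r > 1")
    case True
    then show ?thesis by (simp add: p')
  next
    case False
    then show ?thesis using pd0(1)[where r = r and \<alpha> = \<alpha> and \<phi> = \<phi>, OF _ that] by simp
  qed
  have chi: "pair chi \<rho> \<psi> = pair_r chi 1 (conv_sharp \<rho> \<psi>) + pair chi 1 (conv_flat \<rho> \<psi>)"
    if "\<rho> \<ge> 1" "test1 \<psi>" for \<rho> \<psi>
  proof (rule weak_solution_representation[OF _ _ _ that])
    fix \<phi> and \<alpha> :: real
    assume \<phi>: "test2 \<phi>" and "1 < \<alpha>" "\<And>r v. r < \<alpha> \<Longrightarrow> \<phi> r v = 0"
    then have \<alpha>: "1 < \<alpha>" "\<forall>r v. r < \<alpha> \<longrightarrow> \<phi> r v = 0" by auto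
    have "(LBINT r. LBINT v. chi r v * (pd_r (pd_r \<phi>) r v - (kprime p r)\<^sup>2 * pd_v (pd_v \<phi>) r v)) = 0"
      using assms(4) \<phi> by (simp add: entropy_kernel_def)
    then show "(LBINT r. LBINT v. chi r v * (pd_r (pd_r \<phi>) r v - pd_v (pd_v \<phi>) r v / r\<^sup>2)) = 0"
      unfolding k[OF \<alpha>] .
  qed (use assms(4) in \<open>simp_all add: entropy_kernel_def\<close>)
  have h: "pair h \<rho> \<psi> = pair_r h 1 (conv_sharp \<rho> \<psi>) + pair h 1 (conv_flat \<rho> \<psi>)"
    if "\<rho> \<ge> 1" "test1 \<psi>" for \<rho> \<psi>
  proof (rule weak_solution_representation[OF _ _ _ that])
    fix \<phi> and \<alpha> :: real
    assume \<phi>: "test2 \<phi>" and "1 < \<alpha>" "\<And>r v. r < \<alpha> \<Longrightarrow> \<phi> r v = 0"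
    then have \<alpha>: "1 < \<alpha>" "\<forall>r v. r < \<alpha> \<longrightarrow> \<phi> r v = 0" by auto
    have "(LBINT r. LBINT v. h r v * (pd_r (pd_r \<phi>) r v - (kprime p r)\<^sup>2 * pd_v (pd_v \<phi>) r v))
        = - (LBINT r. LBINT v. deriv (deriv p) r / r * chi r v * pd_v \<phi> r v)"
      using assms(5) \<phi> by (simp add: entropy_flux_kernel_def)
    also have "\<dots> = 0" unfolding q[OF \<alpha>] by simp
    finally show "(LBINT r. LBINT v. h r v * (pd_r (pd_r \<phi>) r v - pd_v (pd_v \<phi>) r v / r\<^sup>2)) = 0"
      unfolding k[OF \<alpha>] .
  qed (use assms(5) in \<open>simp_all add: entropy_flux_kernel_def\<close>)
  from chi h show ?thesis by blast
qed

end
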